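(* Let $q:[0,1]\to[0,\infty)$ be a nonnegative differentiable single-barrier function with transition point $x_0\in[0,1]$, and suppose that $|q'(x)|\le q^{*}$ for all $x\in[0,1]$, where $q^{*}=\frac{2}{15}\min\{q(0),q(1)\}$. Let $\lambda_1<\lambda_2<\cdots$ be the eigenvalues of the Dirichlet problem $-y''+q(x)y=\lambda y$ on $[0,1]$, $y(0)=y(1)=0$. Then $$\frac{\lambda_n}{\lambda_m}\le\frac{n^2}{m^2}\qquad\text{whenever } \lambda_n>\lambda_m\ge 11\,q(x_0).$$ In particular, if $q$ satisfies the additional condition $q(x_0)\le\frac{\pi^2}{11}$, then $\frac{\lambda_n}{\lambda_m}\le\frac{n^2}{m^2}$ for all integers $n>m\ge1$. Moreover, if equality $\frac{\lambda_n}{\lambda_m}=\frac{n^2}{m^2}$ holds for two different such indices $m$ and $n$ (that is, with $\lambda_n>\lambda_m\ge 11q(x_0)$), then $q\equiv0$ on $[0,1]$.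
   Context: A function $q$ on $[0,1]$ is called single-barrier with transition point $x_0\in[0,1]$ if it is monotone increasing (in the non-strict sense) on $[0,x_0]$ and monotone decreasing (non-strict) on $[x_0,1]$. Differentiability at the endpoints of $[0,1]$ is understood as one-sided. The eigenvalues of the Dirichlet problem form a strictly increasing sequence $\lambda_1<\lambda_2<\cdots\to\infty$, indexed from $1$. *)

theory Defs
  imports Complex_Main
begin

definition single_barrier :: "(real \<Rightarrow> real) \<Rightarrow> real \<Rightarrow> bool" where
  "single_barrier q x0 \<longleftrightarrow>
     x0 \<in> {0..1} \<and> mono_on {0..x0} q \<and> antimono_on {x0..1} q"

(* Solutions are classical and real-valued: the potentials considered are continuous and real
   and the problem is self-adjoint, so its eigenvalues are real with real eigenfunctions.
   Derivatives within {0..1} are one-sided at the endpoints. *)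
definition dirichlet_eigenvalue :: "(real \<Rightarrow> real) \<Rightarrow> real \<Rightarrow> bool" where
  "dirichlet_eigenvalue q l \<longleftrightarrow>
     (\<exists>y y' y''.
        (\<forall>x\<in>{0..1}. (y has_real_derivative y' x) (at x within {0..1}) \<and>
                     (y' has_real_derivative y'' x) (at x within {0..1}) \<and>
                     - y'' x + q x * y x = l * y x) \<and>
        y 0 = 0 \<and> y 1 = 0 \<and>
        (\<exists>x\<in>{0..1}. y x \<noteq> 0))"

(* The sequence is indexed from 1, the value lam 0 is irrelevant.
   Strict monotonicity and the range determine lam on {1..} uniquely. *)
definition dirichlet_eigenvalue_seq :: "(real \<Rightarrow> real) \<Rightarrow> (nat \<Rightarrow> real) \<Rightarrow> bool" where
  "dirichlet_eigenvalue_seq q lam \<longleftrightarrow>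
     strict_mono_on {1..} lam \<and> lam ` {1..} = {l. dirichlet_eigenvalue q l}"

end

theory Submission
  imports Defs "HOL-Analysis.Analysis"
begin

text \<open>Write \<open>\<lambda> = z\<^sup>2\<close> and use the Pruefer angle \<open>\<phi>\<close> with \<open>y = r sin \<phi>\<close>, \<open>y' = z r cos \<phi>\<close>, so that
  \<open>\<phi>' = z - (q/z) sin\<^sup>2 \<phi>\<close> and the \<open>n\<close>-th eigenvalue is the solution of \<open>\<phi>(1, z) = n\<pi>\<close>.
  The ratio bound says that \<open>\<phi>(1, z) / z\<close> is at least as large at the \<open>n\<close>-th as at the \<open>m\<close>-th
  eigenvalue, and it suffices that \<open>\<psi> = z \<partial>\<phi>/\<partial>z - \<phi>\<close> is positive at \<open>x = 1\<close> for all \<open>z\<close> in between.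
  One finds \<open>(z\<^sup>2 r\<^sup>2 \<psi> + q y\<^sup>2 \<phi>)' = q y\<^sup>2 (2z + \<phi>') + q' y\<^sup>2 \<phi>\<close>.
  Here \<open>q' y\<^sup>2 \<phi>\<close> is a small fraction of the first term, because the barrier shape makes
  \<open>min {q 0, q 1}\<close> a lower bound of \<open>q\<close>; and \<open>q y\<^sup>2 \<phi>\<close> at \<open>x = 1\<close> is below the integral of this derivative,
  since the energy \<open>y'\<^sup>2 + (z\<^sup>2 - q) y\<^sup>2\<close> is nearly constant. If \<open>min {q 0, q 1} = 0\<close>, then \<open>q\<close> vanishes.\<close>

section \<open>Differential equations on an interval\<close>

lemma mono_of_deriv_nonneg:
  fixes f f' :: "real \<Rightarrow> real"
  assumes f': "\<And>x. x \<in> {a..b} \<Longrightarrow> (f has_real_derivative f' x) (at x within {a..b})"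
    and nonneg: "\<And>x. x \<in> {a..b} \<Longrightarrow> 0 \<le> f' x"
    and st: "a \<le> s" "s \<le> t" "t \<le> b"
  shows "f s \<le> f t"
proof (rule DERIV_nonneg_imp_increasing_open[OF st(2)])
  fix x assume x: "s < x" "x < t"
  \<comment> \<open>Strictly between \<open>s\<close> and \<open>t\<close> the derivative within the
    interval is two-sided; the end points enter only through continuity.\<close>
  then have "(f has_real_derivative f' x) (at x)"
    using f'[of x] st by (simp add: at_within_Icc_at)
  with nonneg[of x] x st show "\<exists>y. (f has_real_derivative y) (at x) \<and> 0 \<le> y" by auto
next
  have "continuous_on {a..b} f"
    using f' by (meson DERIV_continuous continuous_on_eq_continuous_within)
  then show "continuous_on {s..t} f"
    using st by (auto intro: continuous_on_subset)
qed

lemma strict_mono_of_deriv_pos: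
  fixes f f' :: "real \<Rightarrow> real"
  assumes f': "\<And>x. x \<in> {a..b} \<Longrightarrow> (f has_real_derivative f' x) (at x within {a..b})"
    and pos: "\<And>x. x \<in> {a..b} \<Longrightarrow> 0 < f' x"
    and st: "a \<le> s" "s < t" "t \<le> b"
  shows "f s < f t"
proof (rule DERIV_pos_imp_increasing_open[OF st(2)])
  fix x assume x: "s < x" "x < t"
  then have "(f has_real_derivative f' x) (at x)"
    using f'[of x] st by (simp add: at_within_Icc_at)
  with pos[of x] x st show "\<exists>y. (f has_real_derivative y) (at x) \<and> 0 < y" by auto
next
  have "continuous_on {a..b} f"
    using f' by (meson DERIV_continuous continuous_on_eq_continuous_within)
  then show "continuous_on {s..t} f"
    using st by (auto intro: continuous_on_subset)
qed

lemma const_of_deriv_zero: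
  fixes f :: "real \<Rightarrow> real"
  assumes f': "\<And>x. x \<in> {a..b} \<Longrightarrow> (f has_real_derivative 0) (at x within {a..b})"
    and x: "x \<in> {a..b}"
  shows "f x = f a"
proof (rule antisym)
  show "f a \<le> f x"
    using mono_of_deriv_nonneg[of a b f "\<lambda>_. 0" a x] f' x by auto
  have "((\<lambda>x. - f x) has_real_derivative 0) (at x within {a..b})" if "x \<in> {a..b}" for x
    using f'[OF that] by (auto intro!: derivative_eq_intros)
  then have "- f a \<le> - f x"
    using mono_of_deriv_nonneg[of a b "\<lambda>x. - f x" "\<lambda>_. 0" a x] x by auto
  then show "f x \<le> f a" by simp
qed

lemma continuous_on_of_deriv:
  fixes f f' :: "real \<Rightarrow> real"
  assumes "\<And>x. x \<in> S \<Longrightarrow> (f has_real_derivative f' x) (at x within S)"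
  shows "continuous_on S f"
  using assms by (meson DERIV_continuous continuous_on_eq_continuous_within)

text \<open>The weight \<open>exp (-K (x - a))\<close> with \<open>K > 2 L\<close> makes the Picard operator a contraction on the whole
  interval at once; \<open>cl\<close> extends functions constantly, so that they become bounded and continuous on the line.\<close>

lemma scalar_ode_solution_exists:
  fixes f :: "real \<Rightarrow> real \<Rightarrow> real"
  assumes ab: "a \<le> b"
    and cont: "\<And>p. continuous_on {a..b} p \<Longrightarrow> continuous_on {a..b} (\<lambda>x. f x (p x))"
    and lip: "\<And>x u v. x \<in> {a..b} \<Longrightarrow> \<bar>f x u - f x v\<bar> \<le> L * \<bar>u - v\<bar>"
  obtains p where "p a = c"
    "\<And>x. x \<in> {a..b} \<Longrightarrow> (p has_real_derivative f x (p x)) (at x within {a..b})"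
proof -
  define K where "K = 2 * \<bar>L\<bar> + 1"
  define cl where "cl x = max a (min b x)" for x :: real
  define P where "P u x = exp (K * (x - a)) * apply_bcontfun u x" for u :: "real \<Rightarrow>\<^sub>C real" and x
  define F where "F u x = c + integral {a..x} (\<lambda>s. f s (P u s))" for u x
  define T where "T u = Bcontfun (\<lambda>x. exp (- K * (cl x - a)) * F u (cl x))" for u
  have exp_K: "exp (- K * s) * exp (K * s) = 1" for s by (simp flip: exp_add)
  have cl: "cl x \<in> {a..b}" for x using ab by (auto simp: cl_def)
  have cl_id: "cl x = x" if "x \<in> {a..b}" for x using that by (auto simp: cl_def)
  have contP: "continuous_on {a..b} (P u)" for u
    unfolding P_def by (intro continuous_intros continuous_on_apply_bcontfun)
  have F': "(F u has_real_derivative f x (P u x)) (at x within {a..b})" if "x \<in> {a..b}" for u x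
    unfolding F_def
    using integral_has_real_derivative[OF cont[OF contP[of u]] that]
    by (auto intro!: derivative_eq_intros)
  have contF: "continuous_on {a..b} (F u)" for u
    using F' by (rule continuous_on_of_deriv)
  have contcl: "continuous_on UNIV cl" unfolding cl_def by (intro continuous_intros)
  have T_apply: "apply_bcontfun (T u) x = exp (- K * (cl x - a)) * F u (cl x)" for u x
  proof -
    have c: "continuous_on {a..b} (\<lambda>x. exp (- K * (x - a)) * F u x)"
      by (intro continuous_intros contF)
    have "continuous_on UNIV ((\<lambda>x. exp (- K * (x - a)) * F u x) \<circ> cl)"
      using cl by (intro continuous_on_compose contcl continuous_on_subset[OF c]) blast
    moreover have "bounded (range ((\<lambda>x. exp (- K * (x - a)) * F u x) \<circ> cl))"
      by (rule bounded_subset[OF compact_imp_bounded[OF compact_continuous_image[OF c compact_Icc]]])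
        (use cl in auto)
    ultimately have "(\<lambda>x. exp (- K * (cl x - a)) * F u (cl x)) \<in> bcontfun"
      by (simp add: bcontfun_def o_def)
    then show ?thesis by (simp add: T_def Bcontfun_inverse)
  qed
  have contraction: "dist (T u) (T v) \<le> 1/2 * dist u v" for u v
  proof (rule dist_bound)
    fix x
    define t where "t = cl x"
    have t: "t \<in> {a..b}" using cl by (simp add: t_def)
    let ?d = "dist u v"
    \<comment> \<open>The comparison function grows at least as fast as \<open>F u - F v\<close> can
      change, so \<open>?g\<close> is increasing. The two signs \<sigma> together bound the absolute
      value.\<close>
    let ?g = "\<lambda>\<sigma> x. ?d / 2 * exp (K * (x - a)) + \<sigma> * (F u x - F v x)"
    have K: "K > 0" "\<bar>L\<bar> \<le> K / 2" by (auto simp: K_def)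
    have d: "\<bar>f s (P u s) - f s (P v s)\<bar> \<le> ?d / 2 * (K * exp (K * (s - a)))" if "s \<in> {a..b}" for s
    proof -
      have "\<bar>f s (P u s) - f s (P v s)\<bar> \<le> L * \<bar>P u s - P v s\<bar>" by (rule lip[OF that])
      also have "\<dots> \<le> K / 2 * \<bar>P u s - P v s\<bar>"
        using K by (intro mult_right_mono) auto
      also have "\<bar>P u s - P v s\<bar> = exp (K * (s - a)) * dist (apply_bcontfun u s) (apply_bcontfun v s)"
        by (simp add: P_def dist_real_def abs_mult flip: right_diff_distrib)
      also have "\<dots> \<le> exp (K * (s - a)) * ?d"
        by (intro mult_left_mono dist_bounded) auto
      finally show ?thesis using K by (simp add: field_simps)
    qed
    have sgn: "0 \<le> ?g \<sigma> t" if "\<bar>\<sigma>\<bar> = 1" for \<sigma>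
    proof -
      have "?g \<sigma> a \<le> ?g \<sigma> t"
      proof (rule mono_of_deriv_nonneg[where f = "?g \<sigma>" and a = a and b = b])
        fix s assume s: "s \<in> {a..b}"
        show "(?g \<sigma> has_real_derivative ?d / 2 * (K * exp (K * (s - a)))
                 + \<sigma> * (f s (P u s) - f s (P v s))) (at s within {a..b})"
          using F'[OF s, of u] F'[OF s, of v] by (auto intro!: derivative_eq_intros)
        have "\<bar>\<sigma> * (f s (P u s) - f s (P v s))\<bar> \<le> ?d / 2 * (K * exp (K * (s - a)))"
          using d[OF s] that by (simp add: abs_mult)
        then show "0 \<le> ?d / 2 * (K * exp (K * (s - a))) + \<sigma> * (f s (P u s) - f s (P v s))"
          by linarith
      qed (use t in auto)
      moreover have "?g \<sigma> a = ?d / 2" by (simp add: F_def)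
      ultimately show ?thesis using zero_le_dist[of u v] by linarith
    qed
    have "\<bar>F u t - F v t\<bar> \<le> ?d / 2 * exp (K * (t - a))"
      using sgn[of 1] sgn[of "-1"] by (intro abs_leI) auto
    then have "exp (- K * (t - a)) * \<bar>F u t - F v t\<bar> \<le> exp (- K * (t - a)) * (?d / 2 * exp (K * (t - a)))"
      by (intro mult_left_mono) auto
    also have "\<dots> = ?d / 2 * (exp (- K * (t - a)) * exp (K * (t - a)))" by (simp only: mult_ac)
    also have "\<dots> = ?d / 2" by (simp only: exp_K mult_1_right)
    finally show "dist (apply_bcontfun (T u) x) (apply_bcontfun (T v) x) \<le> 1/2 * dist u v"
      by (simp add: T_apply dist_real_def abs_mult t_def flip: right_diff_distrib)
  qed
  obtain u where u: "T u = u"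
    using banach_fix_type[of "1/2" T] contraction by auto
  \<comment> \<open>Cancelling the weight turns the fixed point equation into the integral form of
    the differential equation.\<close>
  have Pu: "P u x = F u x" if "x \<in> {a..b}" for x
  proof -
    have "P u x = exp (K * (x - a)) * (exp (- K * (x - a)) * F u x)"
      using T_apply[of u x] u cl_id[OF that] by (simp add: P_def)
    also have "\<dots> = (exp (- K * (x - a)) * exp (K * (x - a))) * F u x" by (simp only: mult_ac)
    finally show ?thesis by (simp only: exp_K mult_1_left)
  qed
  show ?thesis
  proof (rule that[of "F u"])
    show "F u a = c" by (simp add: F_def)
    show "(F u has_real_derivative f x (F u x)) (at x within {a..b})" if "x \<in> {a..b}" for x
      using F'[OF that, of u] Pu[OF that] by simp
  qed
qed

text \<open>Working with \<open>D\<^sup>2\<close> avoids differentiating an absolute value: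
  \<open>2 D D'\<close> is at most \<open>(2 L + 1) D\<^sup>2 + \<epsilon>\<^sup>2\<close>, so
  \<open>exp (- (2 L + 1) x) D\<^sup>2\<close> grows at rate at most
  \<open>\<epsilon>\<^sup>2\<close>. The final square root halves the exponent to
  \<open>L + 1/2\<close>.\<close>

lemma gronwall_zero_initial:
  fixes D D' :: "real \<Rightarrow> real"
  assumes D': "\<And>x. x \<in> {0..1} \<Longrightarrow> (D has_real_derivative D' x) (at x within {0..1})"
    and D0: "D 0 = 0" and \<epsilon>: "0 \<le> \<epsilon>"
    and bound: "\<And>x. x \<in> {0..1} \<Longrightarrow> \<bar>D' x\<bar> \<le> L * \<bar>D x\<bar> + \<epsilon>"
    and x: "x \<in> {0..1}" and L: "0 \<le> L"
  shows "\<bar>D x\<bar> \<le> \<epsilon> * exp (L + 1/2)"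
proof -
  define M where "M = 2 * L + 1"
  have M: "M \<ge> 0" using L by (simp add: M_def)
  let ?g = "\<lambda>x. \<epsilon>\<^sup>2 * x - exp (- M * x) * (D x)\<^sup>2"
  have "?g 0 \<le> ?g x"
  proof (rule mono_of_deriv_nonneg[where f = ?g and a = 0 and b = 1])
    fix s :: real assume s: "s \<in> {0..1}"
    show "(?g has_real_derivative \<epsilon>\<^sup>2 - exp (- M * s) * (2 * D s * D' s - M * (D s)\<^sup>2)) (at s within {0..1})"
      using D'[OF s] by (auto intro!: derivative_eq_intros simp: algebra_simps)
    have "D s * D' s \<le> \<bar>D s\<bar> * \<bar>D' s\<bar>" by (simp add: abs_le_D1 flip: abs_mult)
    also have "\<dots> \<le> \<bar>D s\<bar> * (L * \<bar>D s\<bar> + \<epsilon>)" by (intro mult_left_mono bound s) auto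
    also have "\<dots> = L * (D s)\<^sup>2 + \<bar>D s\<bar> * \<epsilon>" by (simp add: algebra_simps power2_eq_square flip: abs_mult)
    finally have "2 * D s * D' s \<le> 2 * L * (D s)\<^sup>2 + 2 * \<bar>D s\<bar> * \<epsilon>" by simp
    also have "2 * \<bar>D s\<bar> * \<epsilon> \<le> (D s)\<^sup>2 + \<epsilon>\<^sup>2"
      using sum_squares_bound[of "\<bar>D s\<bar>" \<epsilon>] by simp
    finally have *: "2 * D s * D' s - M * (D s)\<^sup>2 \<le> \<epsilon>\<^sup>2" by (simp add: M_def algebra_simps)
    have "exp (- M * s) * (2 * D s * D' s - M * (D s)\<^sup>2) \<le> exp (- M * s) * \<epsilon>\<^sup>2"
      using * by (intro mult_left_mono) auto
    also have "\<dots> \<le> 1 * \<epsilon>\<^sup>2"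
      using M s by (intro mult_right_mono) auto
    finally show "0 \<le> \<epsilon>\<^sup>2 - exp (- M * s) * (2 * D s * D' s - M * (D s)\<^sup>2)" by simp
  qed (use x in auto)
  then have "exp (- M * x) * (D x)\<^sup>2 \<le> \<epsilon>\<^sup>2 * x" by (simp add: D0)
  also have "\<dots> \<le> \<epsilon>\<^sup>2" using x by (simp add: mult_left_le)
  finally have "exp (M * x) * (exp (- M * x) * (D x)\<^sup>2) \<le> exp (M * x) * \<epsilon>\<^sup>2"
    by (intro mult_left_mono) auto
  then have "(D x)\<^sup>2 \<le> exp (M * x) * \<epsilon>\<^sup>2" by (simp add: exp_minus field_simps)
  also have "\<dots> \<le> exp M * \<epsilon>\<^sup>2" using M x by (intro mult_right_mono) (auto simp: mult_left_le)
  also have "exp M = (exp (L + 1/2))\<^sup>2" by (simp add: M_def algebra_simps flip: exp_double)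
  finally have "(D x)\<^sup>2 \<le> (\<epsilon> * exp (L + 1/2))\<^sup>2" by (simp add: power_mult_distrib mult.commute)
  then show ?thesis using \<epsilon> by (simp add: abs_le_square_iff[symmetric] abs_mult)
qed

lemma has_real_derivative_of_quadratic_bound:
  fixes f :: "real \<Rightarrow> real"
  assumes \<delta>: "0 < \<delta>" and bound: "\<And>w. \<bar>w - z\<bar> < \<delta> \<Longrightarrow> \<bar>f w - f z - (w - z) * d\<bar> \<le> C * (w - z)\<^sup>2"
  shows "(f has_real_derivative d) (at z)"
  unfolding has_field_derivative_iff LIM_def
proof (intro allI impI)
  fix e :: real assume e: "0 < e"
  define s where "s = min \<delta> (e / (\<bar>C\<bar> + 1))"
  show "\<exists>s>0. \<forall>w. w \<noteq> z \<and> dist w z < s \<longrightarrow> dist ((f w - f z) / (w - z)) d < e"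
  proof (intro exI[of _ s] conjI allI impI)
    show "0 < s" using \<delta> e by (simp add: s_def)
    fix w assume w: "w \<noteq> z \<and> dist w z < s"
    have h: "\<bar>w - z\<bar> > 0" "\<bar>w - z\<bar> < \<delta>" "\<bar>w - z\<bar> < e / (\<bar>C\<bar> + 1)"
      using w by (auto simp: s_def dist_real_def)
    have "dist ((f w - f z) / (w - z)) d = \<bar>f w - f z - (w - z) * d\<bar> / \<bar>w - z\<bar>"
      using w by (simp add: dist_real_def field_simps flip: abs_divide)
    also have "\<dots> \<le> C * (w - z)\<^sup>2 / \<bar>w - z\<bar>"
      by (intro divide_right_mono bound h) auto
    also have "\<dots> = C * \<bar>w - z\<bar>"
      using h by (simp add: field_simps power2_eq_square)
    also have "\<dots> \<le> (\<bar>C\<bar> + 1) * \<bar>w - z\<bar>" by (intro mult_right_mono) auto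
    also have "\<dots> < e" using h(3) by (simp add: field_simps)
    finally show "dist ((f w - f z) / (w - z)) d < e" .
  qed
qed

section \<open>Lipschitz and second-order estimates for the squared sine\<close>

lemma abs_sin_squared_diff_le: "\<bar>(sin u)\<^sup>2 - (sin v)\<^sup>2\<bar> \<le> \<bar>u - v\<bar>" for u v :: real
proof -
  have "(sin u)\<^sup>2 - (sin v)\<^sup>2 = sin (u - v) * sin (u + v)"
    by (simp add: sin_times_sin cos_double_sin)
  also have "\<bar>\<dots>\<bar> \<le> \<bar>u - v\<bar> * 1"
    unfolding abs_mult by (intro mult_mono abs_sin_x_le_abs_x) auto
  finally show ?thesis by simp
qed

text \<open>With \<open>d = v - u\<close> the remainder is exactly
  \<open>cos (2 u) (sin d)\<^sup>2 + sin (2 u) (sin (2 d) - 2 d) / 2\<close>, and each summand is at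
  most \<open>d\<^sup>2\<close> in absolute value.\<close>

lemma sin_squared_taylor: "\<bar>(sin v)\<^sup>2 - (sin u)\<^sup>2 - sin (2 * u) * (v - u)\<bar> \<le> 2 * (v - u)\<^sup>2" for u v :: real
proof -
  define d where "d = v - u"
  have v: "v = u + d" by (simp add: d_def)
  have sq: "(sin t)\<^sup>2 = (1 - cos (2 * t)) / 2" for t :: real by (simp add: cos_double_sin)
  have "(sin v)\<^sup>2 - (sin u)\<^sup>2 - sin (2 * u) * d
      = cos (2 * u) * (sin d)\<^sup>2 + sin (2 * u) * ((sin (2 * d) - 2 * d) / 2)"
    unfolding sq v distrib_left cos_add by (simp add: algebra_simps add_divide_distrib diff_divide_distrib)
  also have "\<bar>\<dots>\<bar> \<le> 1 * (sin d)\<^sup>2 + 1 * \<bar>(sin (2 * d) - 2 * d) / 2\<bar>"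
    by (rule order_trans[OF abs_triangle_ineq], unfold abs_mult)
      (intro add_mono mult_mono, auto)
  also have "(sin d)\<^sup>2 \<le> d\<^sup>2"
    using abs_sin_x_le_abs_x[of d] by (simp add: abs_le_square_iff)
  also have "\<bar>(sin (2 * d) - 2 * d) / 2\<bar> \<le> d\<^sup>2"
    using Maclaurin_sin_bound[of "2 * d" 2] by (simp add: numeral_2_eq_2 sin_coeff_def power2_eq_square abs_mult)
  finally show ?thesis by (simp add: d_def)
qed

lemma strict_mono_enum_le:
  fixes f g :: "nat \<Rightarrow> 'a :: linorder"
  assumes f: "strict_mono_on {1..} f" and g: "strict_mono_on {1..} g"
    and sub: "g ` {1..} \<subseteq> f ` {1..}" and k: "1 \<le> k"
  shows "f k \<le> g k"
  using k
proof (induction k rule: dec_induct)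
  case base
  obtain j where "1 \<le> j" "g 1 = f j" using sub by fastforce
  then show ?case using strict_mono_on_leD[OF f, of 1 j] by simp
next
  case (step n)
  obtain j where j: "1 \<le> j" "g (Suc n) = f j" using sub step by fastforce
  \<comment> \<open>The value \<open>g (Suc n) = f j\<close> lies strictly above \<open>f n\<close>
    by the induction hypothesis, so \<open>j\<close> is at least \<open>Suc n\<close>.\<close>
  have "g n < g (Suc n)" using strict_mono_onD[OF g, of n "Suc n"] step by simp
  then have "f n < f j" using step j by simp
  then have "n < j"
    using strict_mono_on_leD[OF f, of j n] j step by (cases "n < j") auto
  then show ?case using strict_mono_on_leD[OF f, of "Suc n" j] j by simp
qed

text \<open>This identifies an eigenvalue sequence that is known only by its monotonicity and its
  range.\<close>

lemma strict_mono_enum_unique: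
  fixes f g :: "nat \<Rightarrow> 'a :: linorder"
  assumes "strict_mono_on {1..} f" "strict_mono_on {1..} g" "f ` {1..} = g ` {1..}" "1 \<le> k"
  shows "f k = g k"
  using strict_mono_enum_le[of f g k] strict_mono_enum_le[of g f k] assms by (intro antisym) auto

section \<open>The Pruefer angle\<close>

locale nonneg_potential =
  fixes q :: "real \<Rightarrow> real"
  assumes cont: "continuous_on {0..1} q"
    and nonneg: "\<And>x. x \<in> {0..1} \<Longrightarrow> 0 \<le> q x"
begin

definition bnd :: real where "bnd = (SOME Q. 0 \<le> Q \<and> (\<forall>x\<in>{0..1}. q x \<le> Q))"

lemma bnd_nonneg: "0 \<le> bnd" and le_bnd: "x \<in> {0..1} \<Longrightarrow> q x \<le> bnd"
proof -
  have "bounded (q ` {0..1})"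
    using cont by (intro compact_imp_bounded compact_continuous_image) auto
  then obtain Q where "\<forall>x\<in>{0..1}. \<bar>q x\<bar> \<le> Q" by (auto simp: bounded_iff)
  then have "0 \<le> \<bar>Q\<bar> \<and> (\<forall>x\<in>{0..1}. q x \<le> \<bar>Q\<bar>)" by force
  then have "0 \<le> bnd \<and> (\<forall>x\<in>{0..1}. q x \<le> bnd)" unfolding bnd_def by (rule someI)
  then show "0 \<le> bnd" "x \<in> {0..1} \<Longrightarrow> q x \<le> bnd" by auto
qed

text \<open>The Pruefer angle is introduced through its own first-order initial value problem, so
  that neither a division by \<open>y\<close> nor a branch of an inverse trigonometric function is
  involved.\<close>

definition angle :: "real \<Rightarrow> real \<Rightarrow> real" where
  "angle z = (SOME \<phi>. \<phi> 0 = 0 \<and>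
     (\<forall>x\<in>{0..1}. (\<phi> has_real_derivative z - q x / z * (sin (\<phi> x))\<^sup>2) (at x within {0..1})))"

lemma angle_0 [simp]: "angle z 0 = 0"
  and angle_deriv: "x \<in> {0..1} \<Longrightarrow>
    (angle z has_real_derivative z - q x / z * (sin (angle z x))\<^sup>2) (at x within {0..1})"
proof -
  let ?f = "\<lambda>x u. z - q x / z * (sin u)\<^sup>2"
  have lip: "\<bar>?f x u - ?f x v\<bar> \<le> bnd / \<bar>z\<bar> * \<bar>u - v\<bar>" if "x \<in> {0..1}" for x u v
  proof -
    have "\<bar>?f x u - ?f x v\<bar> = \<bar>q x / z * ((sin v)\<^sup>2 - (sin u)\<^sup>2)\<bar>" by (simp add: algebra_simps)
    also have "\<dots> = q x / \<bar>z\<bar> * \<bar>(sin v)\<^sup>2 - (sin u)\<^sup>2\<bar>" using nonneg[OF that] by (simp add: abs_mult)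
    also have "\<dots> \<le> bnd / \<bar>z\<bar> * \<bar>v - u\<bar>"
      using le_bnd[OF that] bnd_nonneg by (intro mult_mono divide_right_mono abs_sin_squared_diff_le) auto
    finally show ?thesis by (simp add: abs_minus_commute)
  qed
  \<comment> \<open>At \<open>z = 0\<close> the quotient \<open>q x / z\<close> is 0 by convention,
    so the equation still makes sense and \<open>angle z\<close> is defined for every
    \<open>z\<close>.\<close>
  have contf: "continuous_on {0..1} (\<lambda>x. ?f x (p x))" if "continuous_on {0..1} p" for p
    using that by (cases "z = 0") (auto intro!: continuous_intros cont)
  obtain p where "p 0 = 0"
    "\<And>x. x \<in> {0..1} \<Longrightarrow> (p has_real_derivative ?f x (p x)) (at x within {0..1})"
    using scalar_ode_solution_exists[of 0 1 ?f "bnd / \<bar>z\<bar>" 0, OF _ contf lip] by auto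
  then have "\<exists>\<phi>. \<phi> 0 = 0 \<and>
     (\<forall>x\<in>{0..1}. (\<phi> has_real_derivative ?f x (\<phi> x)) (at x within {0..1}))" by blast
  then have *: "angle z 0 = 0 \<and>
     (\<forall>x\<in>{0..1}. (angle z has_real_derivative ?f x (angle z x)) (at x within {0..1}))"
    unfolding angle_def by (rule someI_ex)
  then show "angle z 0 = 0" by blast
  from * show "x \<in> {0..1} \<Longrightarrow> (angle z has_real_derivative ?f x (angle z x)) (at x within {0..1})"
    by blast
qed

lemma continuous_on_angle: "continuous_on {0..1} (angle z)"
  using angle_deriv by (rule continuous_on_of_deriv)

text \<open>A nonnegative potential can only slow the angle down, since
  \<open>\<phi>' \<le> z\<close>. At \<open>x = 1\<close> this becomes the lower bound
  \<open>k \<pi>\<close> for the root of the \<open>k\<close>-th eigenvalue.\<close>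

lemma angle_le:
  assumes "0 < z" "x \<in> {0..1}"
  shows "angle z x \<le> z * x"
proof -
  have "z * 0 - angle z 0 \<le> z * x - angle z x"
  proof (rule mono_of_deriv_nonneg[where f = "\<lambda>x. z * x - angle z x" and a = 0 and b = 1])
    fix s :: real assume s: "s \<in> {0..1}"
    show "((\<lambda>x. z * x - angle z x) has_real_derivative q s / z * (sin (angle z s))\<^sup>2) (at s within {0..1})"
      using angle_deriv[OF s, of z] by (auto intro!: derivative_eq_intros)
    show "0 \<le> q s / z * (sin (angle z s))\<^sup>2" using nonneg[OF s] assms by simp
  qed (use assms in auto)
  then show ?thesis by simp
qed

lemma angle_ge:
  assumes "0 < z"
  shows "z - bnd / z \<le> angle z 1"
proof -
  let ?f = "\<lambda>x. angle z x - (z - bnd / z) * x"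
  have "?f 0 \<le> ?f 1"
  proof (rule mono_of_deriv_nonneg[where f = ?f and a = 0 and b = 1])
    fix s :: real assume s: "s \<in> {0..1}"
    show "(?f has_real_derivative bnd / z - q s / z * (sin (angle z s))\<^sup>2) (at s within {0..1})"
      using angle_deriv[OF s, of z] by (auto intro!: derivative_eq_intros)
    have "q s / z * (sin (angle z s))\<^sup>2 \<le> bnd / z * 1"
      using nonneg[OF s] le_bnd[OF s] assms
      by (intro mult_mono divide_right_mono) (auto simp: abs_square_le_1)
    then show "0 \<le> bnd / z - q s / z * (sin (angle z s))\<^sup>2" by simp
  qed auto
  then show ?thesis by simp
qed

text \<open>Since \<open>sin\<^sup>2 \<phi> \<le> \<bar>\<phi>\<bar>\<close>, the function \<open>exp (-Lx) \<phi>\<close> with \<open>L = bnd / z\<close> strictly increases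
  wherever \<open>\<phi> \<le> 0\<close>, so a nonpositive minimum can only be attained at \<open>0\<close>.\<close>

lemma angle_pos:
  assumes z: "0 < z" and x: "0 < x" "x \<le> 1"
  shows "0 < angle z x"
proof (rule ccontr)
  assume neg: "\<not> 0 < angle z x"
  define L where "L = bnd / z"
  define g where "g x = exp (- L * x) * angle z x" for x
  have g': "(g has_real_derivative exp (- L * s) * (z - q s / z * (sin (angle z s))\<^sup>2 - L * angle z s))
      (at s within {0..1})" if "s \<in> {0..1}" for s
    unfolding g_def
    using angle_deriv[OF that, of z] by (auto intro!: derivative_eq_intros simp: algebra_simps)
  have "continuous_on {0..1} g" using g' by (rule continuous_on_of_deriv)
  then obtain t where t: "t \<in> {0..1}" "\<And>s. s \<in> {0..1} \<Longrightarrow> g t \<le> g s"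
    using continuous_attains_inf[of "{0..1}" g] by auto
  \<comment> \<open>If the minimum is attained at 0, its value is \<open>g 0 = 0\<close>, and
    \<open>g x \<le> 0\<close> makes \<open>x\<close> a minimiser as well. So there is always a
    minimiser \<open>t' > 0\<close>, to the left of which there is room.\<close>
  define t' where "t' = (if t = 0 then x else t)"
  have gx: "g x \<le> 0" using neg by (simp add: g_def mult_nonneg_nonpos)
  have g0: "g 0 = 0" by (simp add: g_def)
  have t': "0 < t'" "t' \<le> 1" "g t' \<le> 0" "\<And>s. s \<in> {0..1} \<Longrightarrow> g t' \<le> g s"
  proof -
    show "0 < t'" "t' \<le> 1" using t(1) x by (auto simp: t'_def)
    have "g t' = g t" using gx g0 t(2)[of x] x by (auto simp: t'_def)
    then show "g t' \<le> 0" "\<And>s. s \<in> {0..1} \<Longrightarrow> g t' \<le> g s"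
      using t(2) t(2)[of 0] g0 by auto
  qed
  have t'01: "t' \<in> {0..1}" using t' by simp
  have "angle z t' \<le> 0" using t'(3) by (simp add: g_def mult_le_0_iff)
  have "q t' / z * (sin (angle z t'))\<^sup>2 \<le> L * \<bar>angle z t'\<bar>"
    unfolding L_def using le_bnd[OF t'01] nonneg[OF t'01] z abs_sin_squared_diff_le[of "angle z t'" 0]
    by (intro mult_mono divide_right_mono) auto
  then have "0 < exp (- L * t') * (z - q t' / z * (sin (angle z t'))\<^sup>2 - L * angle z t')"
    using \<open>angle z t' \<le> 0\<close> z by (intro mult_pos_pos) auto
  from has_real_derivative_pos_inc_left[OF g'[OF t'01] this]
  obtain d where d: "d > 0" "\<And>h. 0 < h \<Longrightarrow> t' - h \<in> {0..1} \<Longrightarrow> h < d \<Longrightarrow> g (t' - h) < g t'" by blast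
  define h where "h = min (d / 2) (t' / 2)"
  have h: "0 < h" "t' - h \<in> {0..1}" "h < d" using d(1) t' by (auto simp: h_def min_def)
  show False using d(2)[OF h] t'(4)[OF h(2)] by simp
qed

lemma angle_nonneg: "0 < z \<Longrightarrow> x \<in> {0..1} \<Longrightarrow> 0 \<le> angle z x"
  using angle_pos[of z x] by (cases "x = 0") auto

text \<open>The Pruefer radius \<open>r\<close>. Once the angle is known, its equation
  \<open>r' = (q/z) sin \<phi> cos \<phi> r\<close> is linear, and the explicit exponential makes
  positivity and the normalisation \<open>r 0 = 1\<close> immediate.\<close>

definition amp :: "real \<Rightarrow> real \<Rightarrow> real" where
  "amp z x = exp (integral {0..x} (\<lambda>t. q t / z * sin (angle z t) * cos (angle z t)))"

lemma amp_pos: "0 < amp z x"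
  by (simp add: amp_def)

lemma amp_0 [simp]: "amp z 0 = 1"
  by (simp add: amp_def)

lemma amp_deriv:
  assumes "0 < z" "x \<in> {0..1}"
  shows "(amp z has_real_derivative q x / z * sin (angle z x) * cos (angle z x) * amp z x)
    (at x within {0..1})"
proof -
  have "continuous_on {0..1} (\<lambda>t. q t / z * sin (angle z t) * cos (angle z t))"
    using assms by (intro continuous_intros cont continuous_on_angle) auto
  from DERIV_chain2[OF DERIV_exp integral_has_real_derivative[OF this assms(2)]] show ?thesis
    unfolding amp_def by (simp only: mult_ac)
qed

definition sol :: "real \<Rightarrow> real \<Rightarrow> real" where "sol z x = amp z x * sin (angle z x)"
definition dsol :: "real \<Rightarrow> real \<Rightarrow> real" where "dsol z x = z * amp z x * cos (angle z x)"

lemma sol_deriv: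
  assumes "0 < z" "x \<in> {0..1}"
  shows "(sol z has_real_derivative dsol z x) (at x within {0..1})"
proof -
  have *: "q x / z * s * c * r * s + c * (z - q x / z * s\<^sup>2) * r = z * r * c" for s c r :: real
    by (simp add: algebra_simps power2_eq_square)
  show ?thesis
    unfolding sol_def dsol_def
    by (rule derivative_eq_intros amp_deriv[OF assms] angle_deriv assms refl)+ (use * in simp)
qed

lemma dsol_deriv:
  assumes "0 < z" "x \<in> {0..1}"
  shows "(dsol z has_real_derivative (q x - z\<^sup>2) * sol z x) (at x within {0..1})"
proof -
  define k where "k = q x / z"
  have k: "q x = z * k" using assms by (simp add: k_def)
  show ?thesis
    unfolding sol_def dsol_def
    by (rule derivative_eq_intros amp_deriv[OF assms] angle_deriv assms refl)+
      (unfold k, use sin_cos_squared_add[of "angle z x"] assms in \<open>simp; algebra\<close>)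
qed

section \<open>Dependence on the spectral parameter\<close>

text \<open>The candidate for \<open>\<partial>\<phi>/\<partial>z\<close>: differentiating the angle
  equation formally in \<open>z\<close> gives a linear equation with integrating factor
  \<open>r\<^sup>2\<close>, and this is its solution with initial value 0 by variation of
  constants.\<close>

definition dangle :: "real \<Rightarrow> real \<Rightarrow> real" where
  "dangle z x = integral {0..x} (\<lambda>t. (amp z t)\<^sup>2 * (1 + q t / z\<^sup>2 * (sin (angle z t))\<^sup>2)) / (amp z x)\<^sup>2"

lemma dangle_0 [simp]: "dangle z 0 = 0"
  by (simp add: dangle_def)

lemma amp_squared_dangle_deriv:
  assumes "0 < z" "x \<in> {0..1}"
  shows "((\<lambda>x. (amp z x)\<^sup>2 * dangle z x) has_real_derivative
    (amp z x)\<^sup>2 * (1 + q x / z\<^sup>2 * (sin (angle z x))\<^sup>2)) (at x within {0..1})"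
proof -
  have "continuous_on {0..1} (amp z)"
    using amp_deriv[OF assms(1)] by (rule continuous_on_of_deriv)
  then have "continuous_on {0..1} (\<lambda>t. (amp z t)\<^sup>2 * (1 + q t / z\<^sup>2 * (sin (angle z t))\<^sup>2))"
    using assms by (intro continuous_intros cont continuous_on_angle) auto
  from integral_has_real_derivative[OF this assms(2)] show ?thesis
    using amp_pos[of z] by (simp add: dangle_def less_imp_neq[symmetric])
qed

lemma dangle_deriv:
  assumes "0 < z" "x \<in> {0..1}"
  shows "(dangle z has_real_derivative
    1 + q x / z\<^sup>2 * (sin (angle z x))\<^sup>2 - q x / z * sin (2 * angle z x) * dangle z x)
    (at x within {0..1})"
proof -
  let ?s = "sin (angle z x)" and ?c = "cos (angle z x)"
  have r: "amp z x \<noteq> 0" for x using amp_pos[of z x] by simp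
  have "((\<lambda>x. (amp z x)\<^sup>2 * dangle z x / (amp z x)\<^sup>2) has_real_derivative
     ((amp z x)\<^sup>2 * (1 + q x / z\<^sup>2 * ?s\<^sup>2) * (amp z x)\<^sup>2
      - (amp z x)\<^sup>2 * dangle z x * (2 * (amp z x * (q x / z * ?s * ?c * amp z x)))) / ((amp z x)\<^sup>2 * (amp z x)\<^sup>2))
     (at x within {0..1})"
    by (rule derivative_eq_intros amp_squared_dangle_deriv amp_deriv assms refl)+
      (use r in \<open>simp_all add: algebra_simps\<close>)
  moreover have "(\<lambda>x. (amp z x)\<^sup>2 * dangle z x / (amp z x)\<^sup>2) = dangle z" using r by auto
  moreover have key: "(R\<^sup>2 * A * R\<^sup>2 - R\<^sup>2 * D * (2 * (R * (B * R)))) / (R\<^sup>2 * R\<^sup>2) = A - B * 2 * D"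
    if "R \<noteq> 0" for R A B D :: real
    using that by (simp add: field_simps power2_eq_square)
  ultimately have "(dangle z has_real_derivative
    1 + q x / z\<^sup>2 * ?s\<^sup>2 - q x / z * ?s * ?c * 2 * dangle z x) (at x within {0..1})"
    by (simp only: key[OF r])
  then show ?thesis by (simp only: sin_double mult.assoc mult.commute[of _ "2::real"] mult.left_commute[of _ "2::real"])
qed

lemma dangle_pos:
  assumes "0 < z"
  shows "0 < dangle z 1"
proof -
  have "(amp z 0)\<^sup>2 * dangle z 0 < (amp z 1)\<^sup>2 * dangle z 1"
  proof (rule strict_mono_of_deriv_pos[where f = "\<lambda>x. (amp z x)\<^sup>2 * dangle z x" and a = 0 and b = 1])
    fix x :: real assume x: "x \<in> {0..1}"
    show "((\<lambda>x. (amp z x)\<^sup>2 * dangle z x) has_real_derivative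
        (amp z x)\<^sup>2 * (1 + q x / z\<^sup>2 * (sin (angle z x))\<^sup>2)) (at x within {0..1})"
      by (rule amp_squared_dangle_deriv[OF assms x])
    show "0 < (amp z x)\<^sup>2 * (1 + q x / z\<^sup>2 * (sin (angle z x))\<^sup>2)"
      using amp_pos[of z x] nonneg[OF x] by (intro mult_pos_pos add_pos_nonneg) auto
  qed auto
  then show ?thesis using amp_pos[of z 1] by (simp add: zero_less_mult_iff)
qed

text \<open>Gronwall applied to the difference of two angles. The restriction on \<open>w\<close>
  keeps \<open>w \<ge> z / 2\<close>, so that \<open>1 / w\<close> is at most
  \<open>2 / z\<close>.\<close>

lemma angle_lipschitz:
  assumes z: "0 < z" and w: "\<bar>w - z\<bar> < z / 2" and x: "x \<in> {0..1}"
  shows "\<bar>angle w x - angle z x\<bar> \<le> \<bar>w - z\<bar> * ((1 + 2 * bnd / z\<^sup>2) * exp (2 * bnd / z + 1/2))"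
proof -
  have w2: "z / 2 \<le> w" "0 < w" using w z by linarith+
  have "\<bar>angle w x - angle z x\<bar> \<le> \<bar>w - z\<bar> * (1 + 2 * bnd / z\<^sup>2) * exp (2 * bnd / z + 1/2)"
  proof (rule gronwall_zero_initial[where D = "\<lambda>x. angle w x - angle z x"])
    fix s :: real assume s: "s \<in> {0..1}"
    let ?a = "angle z s" and ?b = "angle w s"
    show "((\<lambda>x. angle w x - angle z x) has_real_derivative
        (w - q s / w * (sin ?b)\<^sup>2) - (z - q s / z * (sin ?a)\<^sup>2)) (at s within {0..1})"
      by (intro derivative_intros angle_deriv s)
    have "(w - q s / w * (sin ?b)\<^sup>2) - (z - q s / z * (sin ?a)\<^sup>2)
       = (w - z) * (1 + q s / (z * w) * (sin ?a)\<^sup>2) - q s / w * ((sin ?b)\<^sup>2 - (sin ?a)\<^sup>2)"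
      using z w2 by (simp add: field_simps)
    also have "\<bar>\<dots>\<bar> \<le> \<bar>w - z\<bar> * (1 + 2 * bnd / z\<^sup>2) + 2 * bnd / z * \<bar>?b - ?a\<bar>"
    proof (rule order_trans[OF abs_triangle_ineq4], rule add_mono)
      have "q s / (z * w) * (sin ?a)\<^sup>2 \<le> bnd / (z * (z / 2)) * 1"
        using le_bnd[OF s] bnd_nonneg w2 z nonneg[OF s]
        by (intro mult_mono frac_le mult_left_mono) (auto simp: abs_square_le_1)
      moreover have "0 \<le> q s / (z * w) * (sin ?a)\<^sup>2" using nonneg[OF s] z w2 by auto
      ultimately have "\<bar>1 + q s / (z * w) * (sin ?a)\<^sup>2\<bar> \<le> 1 + 2 * bnd / z\<^sup>2"
        using z by (simp add: power2_eq_square mult.commute)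
      then show "\<bar>(w - z) * (1 + q s / (z * w) * (sin ?a)\<^sup>2)\<bar> \<le> \<bar>w - z\<bar> * (1 + 2 * bnd / z\<^sup>2)"
        unfolding abs_mult by (intro mult_left_mono) auto
      have "\<bar>q s / w\<bar> \<le> bnd / (z / 2)"
        using le_bnd[OF s] bnd_nonneg w2 z nonneg[OF s] unfolding abs_divide by (intro frac_le) auto
      also have "\<dots> = 2 * bnd / z" by simp
      finally show "\<bar>q s / w * ((sin ?b)\<^sup>2 - (sin ?a)\<^sup>2)\<bar> \<le> 2 * bnd / z * \<bar>?b - ?a\<bar>"
        unfolding abs_mult[of "q s / w"] using z bnd_nonneg
        by (intro mult_mono[OF _ abs_sin_squared_diff_le]) auto
    qed
    finally show "\<bar>(w - q s / w * (sin ?b)\<^sup>2) - (z - q s / z * (sin ?a)\<^sup>2)\<bar>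
       \<le> 2 * bnd / z * \<bar>?b - ?a\<bar> + \<bar>w - z\<bar> * (1 + 2 * bnd / z\<^sup>2)" by simp
  qed (use x z bnd_nonneg in auto)
  then show ?thesis by (simp only: mult.assoc)
qed

text \<open>The linearisation error \<Delta> of the angle starts at 0 and satisfies a linear
  equation with coefficient at most \<open>bnd / z\<close> and a source of order
  \<open>(w - z)\<^sup>2\<close>; by Gronwall \<Delta> itself is of second order.\<close>

lemma angle_parameter_deriv:
  assumes z: "0 < z"
  shows "((\<lambda>w. angle w 1) has_real_derivative dangle z 1) (at z)"
proof -
  define A where "A = (1 + 2 * bnd / z\<^sup>2) * exp (2 * bnd / z + 1/2)"
  \<comment> \<open>The summands of \<open>B\<close> bound, in this order, the Taylor remainder of
    the squared sine, the product of the changes of the angle and of \<open>1 / z\<close>, and the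
    second-order remainder of \<open>1 / z\<close>.\<close>
  define B where "B = 4 * bnd / z * A\<^sup>2 + 2 * bnd / z\<^sup>2 * A + 2 * bnd / z ^ 3"
  have A: "0 \<le> A" using z bnd_nonneg by (simp add: A_def)
  have B: "0 \<le> B" using z bnd_nonneg A by (simp add: B_def)
  have "\<bar>angle w 1 - angle z 1 - (w - z) * dangle z 1\<bar> \<le> B * exp (bnd / z + 1/2) * (w - z)\<^sup>2"
    if w: "\<bar>w - z\<bar> < z / 2" for w
  proof -
    define h where "h = w - z"
    define \<Delta> where "\<Delta> x = angle w x - angle z x - h * dangle z x" for x
    have w2: "z / 2 \<le> w" "0 < w" using w z by linarith+
    have "\<bar>\<Delta> 1\<bar> \<le> (B * h\<^sup>2) * exp (bnd / z + 1/2)"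
    proof (rule gronwall_zero_initial[where D = \<Delta>])
      fix s :: real assume s: "s \<in> {0..1}"
      let ?a = "angle z s" and ?b = "angle w s" and ?q = "q s"
      let ?D = "?b - ?a" and ?T = "(sin (angle w s))\<^sup>2 - (sin (angle z s))\<^sup>2 - sin (2 * angle z s) * (angle w s - angle z s)"
      show "(\<Delta> has_real_derivative
          (w - ?q / w * (sin ?b)\<^sup>2) - (z - ?q / z * (sin ?a)\<^sup>2)
          - h * (1 + ?q / z\<^sup>2 * (sin ?a)\<^sup>2 - ?q / z * sin (2 * ?a) * dangle z s)) (at s within {0..1})"
        unfolding \<Delta>_def
        by (rule derivative_eq_intros angle_deriv dangle_deriv s z refl)+ simp
      have D: "\<bar>?D\<bar> \<le> \<bar>h\<bar> * A"
        using angle_lipschitz[OF z w s] by (simp add: A_def h_def)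
      have w_eq: "w = z + h" by (simp add: h_def)
      have split: "(w - ?q / w * (sin ?b)\<^sup>2) - (z - ?q / z * (sin ?a)\<^sup>2)
          - h * (1 + ?q / z\<^sup>2 * (sin ?a)\<^sup>2 - ?q / z * sin (2 * ?a) * dangle z s)
        = - (?q / w * ?T) + (?q * sin (2 * ?a) * ?D * (h / (z * w)))
          + (- (?q * (sin ?a)\<^sup>2 * (h\<^sup>2 / (z\<^sup>2 * w)))) - ?q / z * sin (2 * ?a) * \<Delta> s"
      proof -
        have *: "(w - Q / w * SB) - (z - Q / z * SA) - h * (1 + Q / z\<^sup>2 * SA - Q / z * S2 * e)
          = - (Q / w * (SB - SA - S2 * D)) + (Q * S2 * D * (h / (z * w)))
          + (- (Q * SA * (h\<^sup>2 / (z\<^sup>2 * w)))) - Q / z * S2 * (D - h * e)" for Q SA SB S2 e D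
        proof -
          have "1 / w = 1 / z - (w - z) / (z * w)"
            using z w2 by (simp add: field_simps)
          then have "1 / w = 1 / z - h / (z * w)" by (simp only: h_def)
          moreover have "1 / z\<^sup>2 = (1 / z)\<^sup>2"
            "h\<^sup>2 / (z\<^sup>2 * w) = (1 / z) * h * (h / (z * w))"
            "h / (z * w) = h * (1 / z) * (1 / w)"
            using z w2 by (simp_all add: power2_eq_square)
          moreover have "Q / w = Q * (1 / w)" "Q / z = Q * (1 / z)" "Q / z\<^sup>2 = Q * (1 / z\<^sup>2)" by simp_all
          ultimately show ?thesis
            using w_eq by algebra
        qed
        show ?thesis unfolding \<Delta>_def using *[of "?q" "(sin ?b)\<^sup>2" "(sin ?a)\<^sup>2" "sin (2 * ?a)" "dangle z s" ?D]
          by simp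
      qed
      have "\<bar>(w - ?q / w * (sin ?b)\<^sup>2) - (z - ?q / z * (sin ?a)\<^sup>2)
          - h * (1 + ?q / z\<^sup>2 * (sin ?a)\<^sup>2 - ?q / z * sin (2 * ?a) * dangle z s)\<bar>
          \<le> bnd / (z / 2) * (2 * (\<bar>h\<bar> * A)\<^sup>2) + bnd * 1 * (\<bar>h\<bar> * A) * (\<bar>h\<bar> / (z * (z / 2)))
          + bnd * 1 * (\<bar>h\<bar>\<^sup>2 / (z\<^sup>2 * (z / 2))) + bnd / z * 1 * \<bar>\<Delta> s\<bar>"
      proof (unfold split, rule order_trans[OF abs_triangle_ineq4], rule add_mono,
             rule order_trans[OF abs_triangle_ineq], rule add_mono,
             rule order_trans[OF abs_triangle_ineq], rule add_mono)
        note b = le_bnd[OF s] nonneg[OF s] bnd_nonneg z w2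
        have T: "\<bar>?T\<bar> \<le> 2 * (\<bar>h\<bar> * A)\<^sup>2"
          using sin_squared_taylor[of ?b ?a] power_mono[OF D, of 2] by simp
        show "\<bar>- (?q / w * ?T)\<bar> \<le> bnd / (z / 2) * (2 * (\<bar>h\<bar> * A)\<^sup>2)"
          unfolding abs_minus_cancel abs_mult[of "?q / w"] abs_divide using b by (intro mult_mono[OF _ T] frac_le) auto
        show "\<bar>?q * sin (2 * ?a) * ?D * (h / (z * w))\<bar> \<le> bnd * 1 * (\<bar>h\<bar> * A) * (\<bar>h\<bar> / (z * (z / 2)))"
          unfolding abs_mult abs_divide using b A D by (intro mult_mono frac_le) auto
        show "\<bar>- (?q * (sin ?a)\<^sup>2 * (h\<^sup>2 / (z\<^sup>2 * w)))\<bar> \<le> bnd * 1 * (\<bar>h\<bar>\<^sup>2 / (z\<^sup>2 * (z / 2)))"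
          unfolding abs_mult abs_divide abs_minus_cancel using b by (intro mult_mono frac_le) (auto simp: abs_square_le_1)
        show "\<bar>?q / z * sin (2 * ?a) * \<Delta> s\<bar> \<le> bnd / z * 1 * \<bar>\<Delta> s\<bar>"
          unfolding abs_mult abs_divide using b by (intro mult_mono frac_le) auto
      qed
      also have "\<dots> = bnd / z * \<bar>\<Delta> s\<bar> + B * h\<^sup>2"
        unfolding B_def power_mult_distrib power2_abs
        by (simp add: algebra_simps power2_eq_square power3_eq_cube)
      finally show "\<bar>(w - ?q / w * (sin ?b)\<^sup>2) - (z - ?q / z * (sin ?a)\<^sup>2)
          - h * (1 + ?q / z\<^sup>2 * (sin ?a)\<^sup>2 - ?q / z * sin (2 * ?a) * dangle z s)\<bar>
          \<le> bnd / z * \<bar>\<Delta> s\<bar> + B * h\<^sup>2" .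
    qed (use z bnd_nonneg B in \<open>auto simp: \<Delta>_def\<close>)
    then show ?thesis by (simp add: \<Delta>_def h_def mult_ac)
  qed
  with z show ?thesis
    by (intro has_real_derivative_of_quadratic_bound[where \<delta> = "z / 2"]) auto
qed

section \<open>Dirichlet eigenvalues\<close>

lemma amp_squared: "z\<^sup>2 * (sol z x)\<^sup>2 + (dsol z x)\<^sup>2 = z\<^sup>2 * (amp z x)\<^sup>2"
proof -
  have "z\<^sup>2 * (r * s)\<^sup>2 + (z * r * c)\<^sup>2 = z\<^sup>2 * r\<^sup>2" if "s\<^sup>2 + c\<^sup>2 = 1" for r s c :: real
    using that by algebra
  then show ?thesis by (simp add: sol_def dsol_def)
qed

lemma sol_nontrivial:
  assumes "0 < z"
  shows "\<exists>x\<in>{0..1}. sol z x \<noteq> 0"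
proof
  \<comment> \<open>At this point the angle is positive and at most 1, hence below \<pi>, so its
    sine does not vanish.\<close>
  define x where "x = min 1 (1 / z)"
  show x: "x \<in> {0..1}" using assms by (auto simp: x_def)
  have x_pos: "0 < x" using assms by (auto simp: x_def)
  have "angle z x \<le> z * x" by (rule angle_le[OF assms x])
  also have "\<dots> \<le> z * (1 / z)" using assms by (intro mult_left_mono) (auto simp: x_def)
  finally have "angle z x < pi" using assms pi_gt3 by simp
  moreover have "0 < angle z x" using angle_pos[OF assms x_pos] x by auto
  ultimately have "0 < sin (angle z x)" by (rule sin_gt_zero[rotated])
  then show "sol z x \<noteq> 0" using amp_pos[of z x] by (simp add: sol_def)
qed

text \<open>If \<open>l \<le> 0\<close>, then
  \<open>(y y')' = y'\<^sup>2 + (q - l) y\<^sup>2 \<ge> 0\<close>. As \<open>y y'\<close> vanishes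
  at both ends, it vanishes throughout, so \<open>y\<^sup>2\<close> is constant and \<open>y\<close>
  is trivial.\<close>

lemma dirichlet_eigenvalue_pos:
  assumes y: "\<And>x. x \<in> {0..1} \<Longrightarrow> (y has_real_derivative y' x) (at x within {0..1})"
    and y': "\<And>x. x \<in> {0..1} \<Longrightarrow> (y' has_real_derivative y'' x) (at x within {0..1})"
    and eq: "\<And>x. x \<in> {0..1} \<Longrightarrow> - y'' x + q x * y x = l * y x"
    and bc: "y 0 = 0" "y 1 = 0" and nz: "\<exists>x\<in>{0..1}. y x \<noteq> 0"
  shows "0 < l"
proof (rule ccontr)
  assume l: "\<not> 0 < l"
  have mono: "y s * y' s \<le> y t * y' t" if "0 \<le> s" "s \<le> t" "t \<le> 1" for s t
  proof (rule mono_of_deriv_nonneg[where f = "\<lambda>x. y x * y' x" and a = 0 and b = 1])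
    fix x :: real assume x: "x \<in> {0..1}"
    have y'': "y'' x = (q x - l) * y x" using eq[OF x] by (simp add: algebra_simps)
    show "((\<lambda>x. y x * y' x) has_real_derivative (y' x)\<^sup>2 + (q x - l) * (y x)\<^sup>2) (at x within {0..1})"
      by (rule derivative_eq_intros y y' x refl)+ (simp add: y'' algebra_simps power2_eq_square)
    show "0 \<le> (y' x)\<^sup>2 + (q x - l) * (y x)\<^sup>2"
      using nonneg[OF x] l by (intro add_nonneg_nonneg mult_nonneg_nonneg) auto
  qed (use that in auto)
  have yy': "y x * y' x = 0" if "x \<in> {0..1}" for x
    using mono[of 0 x] mono[of x 1] that bc by simp
  have "(y x)\<^sup>2 = (y 0)\<^sup>2" if "x \<in> {0..1}" for x
  proof (rule const_of_deriv_zero[OF _ that, where f = "\<lambda>x. (y x)\<^sup>2"])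
    fix x :: real assume x: "x \<in> {0..1}"
    show "((\<lambda>x. (y x)\<^sup>2) has_real_derivative 0) (at x within {0..1})"
      using y[OF x] yy'[OF x] by (auto intro!: derivative_eq_intros)
  qed
  then show False using nz bc by auto
qed

text \<open>The Wronskian of a Dirichlet solution \<open>y\<close> and \<open>sol z\<close> vanishes, so
  \<open>y z\<^sup>2 r\<^sup>2 = N sol\<close> and \<open>y' z\<^sup>2 r\<^sup>2 = N dsol\<close> with \<open>N = z\<^sup>2 y sol + y' dsol\<close>;
  the quotient \<open>N / r\<^sup>2\<close> is constant.\<close>

lemma dirichlet_solution_angle:
  assumes z: "0 < z"
    and y: "\<And>x. x \<in> {0..1} \<Longrightarrow> (y has_real_derivative y' x) (at x within {0..1})"
    and y': "\<And>x. x \<in> {0..1} \<Longrightarrow> (y' has_real_derivative (q x - z\<^sup>2) * y x) (at x within {0..1})"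
    and bc: "y 0 = 0" "y 1 = 0" and nz: "\<exists>x\<in>{0..1}. y x \<noteq> 0"
  shows "sin (angle z 1) = 0"
proof (rule ccontr)
  assume s1: "sin (angle z 1) \<noteq> 0"
  define N where "N x = z\<^sup>2 * y x * sol z x + y' x * dsol z x" for x
  have W: "y x * dsol z x - y' x * sol z x = 0" if "x \<in> {0..1}" for x
  proof -
    have "y x * dsol z x - y' x * sol z x = y 0 * dsol z 0 - y' 0 * sol z 0"
    proof (rule const_of_deriv_zero[OF _ that, where f = "\<lambda>x. y x * dsol z x - y' x * sol z x"])
      fix x :: real assume x: "x \<in> {0..1}"
      show "((\<lambda>x. y x * dsol z x - y' x * sol z x) has_real_derivative 0) (at x within {0..1})"
        by (rule derivative_eq_intros y y' sol_deriv dsol_deriv x z refl)+ (simp add: algebra_simps)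
    qed
    then show ?thesis using bc by (simp add: sol_def)
  qed
  have yN: "y x * (z\<^sup>2 * (amp z x)\<^sup>2) = N x * sol z x"
    and y'N: "y' x * (z\<^sup>2 * (amp z x)\<^sup>2) = N x * dsol z x" if "x \<in> {0..1}" for x
    using W[OF that] unfolding amp_squared[symmetric] N_def by algebra+
  have const: "N x / (amp z x)\<^sup>2 = N 0 / (amp z 0)\<^sup>2" if "x \<in> {0..1}" for x
  proof (rule const_of_deriv_zero[OF _ that, where f = "\<lambda>x. N x / (amp z x)\<^sup>2"])
    fix x :: real assume x: "x \<in> {0..1}"
    have r: "amp z x \<noteq> 0" using amp_pos[of z x] by simp
    have "(N has_real_derivative 2 * q x * (y' x * sol z x)) (at x within {0..1})"
      unfolding N_def
      by (rule derivative_eq_intros y y' sol_deriv dsol_deriv x z refl)+ (use W[OF x] in algebra)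
    moreover have "2 * q x * (y' x * sol z x) = N x * 2 * (q x / z * sin (angle z x) * cos (angle z x))"
    proof (rule mult_left_cancel[THEN iffD1])
      show "z\<^sup>2 * (amp z x)\<^sup>2 \<noteq> 0" using r z by simp
      show "z\<^sup>2 * (amp z x)\<^sup>2 * (2 * q x * (y' x * sol z x))
        = z\<^sup>2 * (amp z x)\<^sup>2 * (N x * 2 * (q x / z * sin (angle z x) * cos (angle z x)))"
    proof -
      have "z\<^sup>2 * (amp z x)\<^sup>2 * (2 * q x * (y' x * sol z x)) = 2 * q x * sol z x * (N x * dsol z x)"
        using y'N[OF x] by algebra
      then show ?thesis using z by (simp add: sol_def dsol_def power2_eq_square)
    qed
    qed
    ultimately have N': "(N has_real_derivative N x * 2 * (q x / z * sin (angle z x) * cos (angle z x))) (at x within {0..1})"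
      by (simp only:)
    show "((\<lambda>x. N x / (amp z x)\<^sup>2) has_real_derivative 0) (at x within {0..1})"
      by (rule derivative_eq_intros N' amp_deriv x z refl)+
        (use r in \<open>simp_all add: power2_eq_square algebra_simps\<close>)
  qed
  \<comment> \<open>At \<open>x = 1\<close> the left side of \<open>yN\<close> is 0 by the boundary
    condition, while \<open>sol z 1\<close> is nonzero by the assumption to be refuted.\<close>
  have "N 1 = 0" using yN[of 1] bc s1 amp_pos[of z 1] by (simp add: sol_def)
  then have "N x = 0" if "x \<in> {0..1}" for x
    using const[OF that] const[of 1] amp_pos[of z x] by simp
  then have "y x = 0" if "x \<in> {0..1}" for x
    using yN[OF that] that z amp_pos[of z x] by simp
  with nz show False by blast
qed

lemma dirichlet_eigenvalue_iff:
  "dirichlet_eigenvalue q l \<longleftrightarrow> (\<exists>z>0. l = z\<^sup>2 \<and> sin (angle z 1) = 0)"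
proof
  assume "dirichlet_eigenvalue q l"
  then obtain y y' y'' where
    y: "\<And>x. x \<in> {0..1} \<Longrightarrow> (y has_real_derivative y' x) (at x within {0..1})"
    and y': "\<And>x. x \<in> {0..1} \<Longrightarrow> (y' has_real_derivative y'' x) (at x within {0..1})"
    and eq: "\<And>x. x \<in> {0..1} \<Longrightarrow> - y'' x + q x * y x = l * y x"
    and bc: "y 0 = 0" "y 1 = 0" and nz: "\<exists>x\<in>{0..1}. y x \<noteq> 0"
    unfolding dirichlet_eigenvalue_def by blast
  have l: "0 < l" by (rule dirichlet_eigenvalue_pos[OF y y' eq bc nz])
  have "y'' x = (q x - (sqrt l)\<^sup>2) * y x" if "x \<in> {0..1}" for x
    using eq[OF that] l by (simp add: algebra_simps)
  then have "sin (angle (sqrt l) 1) = 0"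
    using l y y' bc nz by (intro dirichlet_solution_angle[of "sqrt l" y y']) auto
  then show "\<exists>z>0. l = z\<^sup>2 \<and> sin (angle z 1) = 0"
    using l by (intro exI[of _ "sqrt l"]) auto
next
  assume "\<exists>z>0. l = z\<^sup>2 \<and> sin (angle z 1) = 0"
  then obtain z where z: "0 < z" "l = z\<^sup>2" "sin (angle z 1) = 0" by blast
  show "dirichlet_eigenvalue q l"
    unfolding dirichlet_eigenvalue_def
  proof (rule exI[of _ "sol z"], rule exI[of _ "dsol z"], rule exI[of _ "\<lambda>x. (q x - z\<^sup>2) * sol z x"], intro conjI ballI)
    fix x :: real assume x: "x \<in> {0..1}"
    show "(sol z has_real_derivative dsol z x) (at x within {0..1})"
      "(dsol z has_real_derivative (q x - z\<^sup>2) * sol z x) (at x within {0..1})"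
      using sol_deriv dsol_deriv z x by auto
    show "- ((q x - z\<^sup>2) * sol z x) + q x * sol z x = l * sol z x"
      using z by (simp add: algebra_simps)
  qed (use z sol_nontrivial in \<open>auto simp: sol_def\<close>)
qed

section \<open>Enumeration of the eigenvalues by the angle at \<open>x = 1\<close>\<close>

lemma angle_strict_mono:
  assumes "0 < z" "z < w"
  shows "angle z 1 < angle w 1"
proof (rule DERIV_pos_imp_increasing[OF assms(2), where f = "\<lambda>z. angle z 1"])
  fix x assume "z \<le> x" "x \<le> w"
  then show "\<exists>d. ((\<lambda>z. angle z 1) has_real_derivative d) (at x) \<and> 0 < d"
    using angle_parameter_deriv[of x] dangle_pos[of x] assms by auto
qed

lemma angle_inj:
  assumes "0 < z" "0 < w" "angle z 1 = angle w 1"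
  shows "z = w"
  using angle_strict_mono[of z w] angle_strict_mono[of w z] assms by (cases z w rule: linorder_cases) auto

lemma angle_surj:
  assumes "0 < c"
  shows "\<exists>z>0. angle z 1 = c"
proof -
  \<comment> \<open>The intermediate value theorem runs from \<open>c\<close>, where the angle is at
    most \<open>c\<close>, to \<open>w\<close>. Since \<open>w \<ge> 1\<close>, the angle there is
    at least \<open>w - bnd / w \<ge> w - bnd = c + 1\<close>.\<close>
  define w where "w = c + bnd + 1"
  have w: "c \<le> w" "1 \<le> w" using assms bnd_nonneg by (auto simp: w_def)
  have "angle c 1 \<le> c" using angle_le[of c 1] assms by simp
  moreover have "c \<le> angle w 1"
  proof -
    have "bnd / w \<le> bnd" using divide_left_mono[of 1 w bnd] w bnd_nonneg by simp
    then show ?thesis using angle_ge[of w] w by (simp add: w_def)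
  qed
  moreover have "continuous_on {c..w} (\<lambda>z. angle z 1)"
    using angle_parameter_deriv[OF less_le_trans[OF assms]]
    by (intro DERIV_atLeastAtMost_imp_continuous_on) blast
  ultimately obtain z where "c \<le> z" "z \<le> w" "angle z 1 = c"
    using IVT'[of "\<lambda>z. angle z 1" c c w] w by auto
  then show ?thesis using assms by (intro exI[of _ z]) auto
qed

definition root_eigenvalue :: "nat \<Rightarrow> real" where
  "root_eigenvalue k = (SOME z. 0 < z \<and> angle z 1 = real k * pi)"

lemma root_eigenvalue:
  assumes "1 \<le> k"
  shows "0 < root_eigenvalue k" "angle (root_eigenvalue k) 1 = real k * pi"
proof -
  have "\<exists>z. 0 < z \<and> angle z 1 = real k * pi" using angle_surj[of "real k * pi"] assms by auto
  then have "0 < root_eigenvalue k \<and> angle (root_eigenvalue k) 1 = real k * pi"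
    unfolding root_eigenvalue_def by (rule someI_ex)
  then show "0 < root_eigenvalue k" "angle (root_eigenvalue k) 1 = real k * pi" by auto
qed

lemma root_eigenvalue_less:
  assumes "1 \<le> j" "j < k"
  shows "root_eigenvalue j < root_eigenvalue k"
proof (rule ccontr)
  assume "\<not> ?thesis"
  then have "angle (root_eigenvalue k) 1 \<le> angle (root_eigenvalue j) 1"
    using angle_strict_mono[of "root_eigenvalue k" "root_eigenvalue j"] root_eigenvalue(1)[of k] assms
    by (cases "root_eigenvalue k = root_eigenvalue j") auto
  then show False using root_eigenvalue(2)[of j] root_eigenvalue(2)[of k] assms by simp
qed

lemma root_eigenvalue_ge:
  assumes "1 \<le> k"
  shows "real k * pi \<le> root_eigenvalue k"
  using angle_le[of "root_eigenvalue k" 1] root_eigenvalue[OF assms] by simp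

text \<open>The zeros of the sine are the integer multiples of \<pi>. Positivity of the angle leaves
  the positive multiples, and injectivity in \<open>z\<close> gives one root for each.\<close>

lemma dirichlet_spectrum: "{l. dirichlet_eigenvalue q l} = (\<lambda>k. (root_eigenvalue k)\<^sup>2) ` {1..}"
proof (intro set_eqI iffI)
  fix l assume "l \<in> {l. dirichlet_eigenvalue q l}"
  then obtain z where z: "0 < z" "l = z\<^sup>2" "sin (angle z 1) = 0"
    unfolding mem_Collect_eq dirichlet_eigenvalue_iff by blast
  then obtain i :: int where i: "angle z 1 = of_int i * pi" by (auto simp: sin_zero_iff_int2)
  have "0 < of_int i * pi" using angle_pos[OF z(1), of 1] i by simp
  then have "0 < i" by (simp add: zero_less_mult_iff)
  define k where "k = nat i"
  have k: "i = int k" "1 \<le> k" using \<open>0 < i\<close> unfolding k_def by simp_all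
  then have "z = root_eigenvalue k"
    using angle_inj[of z "root_eigenvalue k"] root_eigenvalue[of k] z(1) i by simp
  then show "l \<in> (\<lambda>k. (root_eigenvalue k)\<^sup>2) ` {1..}" using k z by auto
next
  fix l assume "l \<in> (\<lambda>k. (root_eigenvalue k)\<^sup>2) ` {1..}"
  then obtain k where k: "1 \<le> k" "l = (root_eigenvalue k)\<^sup>2" by auto
  have "sin (real k * pi) = 0" by (rule sin_npi)
  then show "l \<in> {l. dirichlet_eigenvalue q l}"
    unfolding mem_Collect_eq dirichlet_eigenvalue_iff
    using k root_eigenvalue[OF k(1)] by (intro exI[of _ "root_eigenvalue k"]) simp
qed

lemma dirichlet_eigenvalue_seq_eq:
  assumes "dirichlet_eigenvalue_seq q lam" "1 \<le> k"
  shows "lam k = (root_eigenvalue k)\<^sup>2"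
proof (rule strict_mono_enum_unique[OF _ _ _ assms(2)])
  show "strict_mono_on {1..} lam" "lam ` {1..} = (\<lambda>k. (root_eigenvalue k)\<^sup>2) ` {1..}"
    using assms(1) by (auto simp: dirichlet_eigenvalue_seq_def dirichlet_spectrum)
  show "strict_mono_on {1..} (\<lambda>k. (root_eigenvalue k)\<^sup>2)"
  proof (rule strict_mono_onI)
    fix i j :: nat assume "i \<in> {1..}" "i < j"
    then show "(root_eigenvalue i)\<^sup>2 < (root_eigenvalue j)\<^sup>2"
      using root_eigenvalue_less[of i j] root_eigenvalue(1)[of i] by (intro power_strict_mono) auto
  qed
qed

section \<open>Eigenvalue ratios\<close>

text \<open>The conclusion says that \<open>angle z 1 / z\<close> has positive derivative in
  \<open>z\<close>. The assumptions \<open>slow\<close> and \<open>drop\<close> record what the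
  barrier shape and the bound on \<open>q'\<close> yield, and \<open>small\<close> comes from the
  threshold on the lower eigenvalue.\<close>

lemma angle_quotient_deriv_pos:
  assumes q': "\<And>x. x \<in> {0..1} \<Longrightarrow> (q has_real_derivative q' x) (at x within {0..1})"
    and z: "3 \<le> z"
    and small: "\<And>x. x \<in> {0..1} \<Longrightarrow> 11 * q x \<le> z\<^sup>2"
    and slow: "\<And>x. x \<in> {0..1} \<Longrightarrow> \<bar>q' x\<bar> \<le> 2 / 15 * q x"
    and drop: "\<And>x. x \<in> {0..1} \<Longrightarrow> 13 / 15 * q 1 \<le> q x"
    and q1: "0 < q 1"
  shows "angle z 1 < z * dangle z 1"
proof -
  have z0: "0 < z" using z by simp
  \<comment> \<open>The energy of the solution; along it only the term \<open>- q' y\<^sup>2\<close>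
    survives differentiation.\<close>
  define E where "E x = (dsol z x)\<^sup>2 + (z\<^sup>2 - q x) * (sol z x)\<^sup>2" for x
  \<comment> \<open>The subtracted term turns the boundary estimate into a monotonicity statement:
    since \<open>(y y')' = E - 2 (z\<^sup>2 - q) y\<^sup>2\<close>, near-constancy of
    \<open>E\<close> bounds \<open>74/75 E 1 - y y'\<close> at \<open>x = 1\<close> by the integral
    of \<open>2 z\<^sup>2 y\<^sup>2\<close>. The factor \<open>6/5\<close> leaves room on both
    sides: \<open>H\<close> must increase, and the subtracted term must exceed
    \<open>q y\<^sup>2 \<phi>\<close> at \<open>x = 1\<close>.\<close>
  define H where "H x = z\<^sup>2 * (z * ((amp z x)\<^sup>2 * dangle z x) - (amp z x)\<^sup>2 * angle z x)
      + q x * (sol z x)\<^sup>2 * angle z x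
      - 6 / 5 * q 1 / z * (74 / 75 * E 1 * x - sol z x * dsol z x)" for x
  have E': "(E has_real_derivative - (q' x * (sol z x)\<^sup>2)) (at x within {0..1})" if x: "x \<in> {0..1}" for x
    unfolding E_def
    by (rule derivative_eq_intros q' sol_deriv dsol_deriv x z0 refl)+ (simp add: algebra_simps power2_eq_square)
  have E_ge: "10 / 11 * z\<^sup>2 * (sol z x)\<^sup>2 \<le> E x - (dsol z x)\<^sup>2" if x: "x \<in> {0..1}" for x
  proof -
    have "10 / 11 * z\<^sup>2 \<le> z\<^sup>2 - q x" using small[OF x] by simp
    from mult_right_mono[OF this zero_le_power2[of "sol z x"]] show ?thesis by (simp add: E_def)
  qed
  have E_nonneg: "0 \<le> E x" if x: "x \<in> {0..1}" for x
    using E_ge[OF x] zero_le_power2[of "dsol z x"]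
      mult_nonneg_nonneg[OF zero_le_power2[of z] zero_le_power2[of "sol z x"]] by linarith
  \<comment> \<open>From \<open>\<bar>q'\<bar> \<le> 2/165 z\<^sup>2\<close> and
    \<open>10/11 z\<^sup>2 y\<^sup>2 \<le> E\<close> follows \<open>E' \<le> E / 75\<close>, and
    \<open>exp (- 1/75) \<ge> 74/75\<close>.\<close>
  have E1_le: "74 / 75 * E 1 \<le> E x" if x: "x \<in> {0..1}" for x
  proof -
    let ?g = "\<lambda>x. - (exp (- x / 75) * E x)"
    have "?g x \<le> ?g 1"
    proof (rule mono_of_deriv_nonneg[where f = ?g and a = 0 and b = 1])
      fix t :: real assume t: "t \<in> {0..1}"
      show "(?g has_real_derivative exp (- t / 75) * (q' t * (sol z t)\<^sup>2 + E t / 75)) (at t within {0..1})"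
        using E'[OF t] by (auto intro!: derivative_eq_intros simp: algebra_simps)
      have "\<bar>q' t\<bar> \<le> 2 / 165 * z\<^sup>2" using slow[OF t] small[OF t] by simp
      then have "\<bar>q' t\<bar> * (sol z t)\<^sup>2 \<le> 2 / 165 * z\<^sup>2 * (sol z t)\<^sup>2" by (rule mult_right_mono) simp
      also have "\<dots> \<le> E t / 75" using E_ge[OF t] zero_le_power2[of "dsol z t"] by linarith
      finally have "- (E t / 75) \<le> q' t * (sol z t)\<^sup>2"
        using abs_ge_minus_self[of "q' t * (sol z t)\<^sup>2"] by (simp add: abs_mult)
      then show "0 \<le> exp (- t / 75) * (q' t * (sol z t)\<^sup>2 + E t / 75)" by simp
    qed (use x in auto)
    then have "exp (- 1 / 75) * E 1 \<le> exp (- x / 75) * E x" by simp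
    also have "\<dots> \<le> 1 * E x" using E_nonneg[OF x] x by (intro mult_right_mono) auto
    finally have "exp (- 1 / 75) * E 1 \<le> E x" by simp
    moreover have "74 / 75 * E 1 \<le> exp (- 1 / 75) * E 1"
      using exp_ge_add_one_self[of "- 1 / 75"] E_nonneg[of 1] by (intro mult_right_mono) auto
    ultimately show ?thesis by simp
  qed
  have "H 0 \<le> H 1"
  proof (rule mono_of_deriv_nonneg[where f = H and a = 0 and b = 1])
    fix x :: real assume x: "x \<in> {0..1}"
    let ?y = "sol z x" and ?v = "dsol z x" and ?p = "angle z x" and ?s = "sin (angle z x)" and ?r = "amp z x"
    define k where "k = q x / z"
    have qk: "q x = z * k" using z0 by (simp add: k_def)
    define H' where "H' = q x * ?y\<^sup>2 * (2 * z + (z - k * ?s\<^sup>2)) + q' x * ?y\<^sup>2 * ?p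
        - 6 / 5 * q 1 / z * (74 / 75 * E 1 - (?v\<^sup>2 + (q x - z\<^sup>2) * ?y\<^sup>2))"
    have "(H has_real_derivative H') (at x within {0..1})"
    proof -
      have d1: "((\<lambda>x. z\<^sup>2 * (z * ((amp z x)\<^sup>2 * dangle z x) - (amp z x)\<^sup>2 * angle z x)) has_real_derivative
          z\<^sup>2 * (z * (?r\<^sup>2 * (1 + q x / z\<^sup>2 * ?s\<^sup>2))
            - (2 * ?r * (q x / z * ?s * cos ?p * ?r) * ?p + (z - q x / z * ?s\<^sup>2) * ?r\<^sup>2))) (at x within {0..1})"
        by (rule derivative_eq_intros amp_squared_dangle_deriv amp_deriv angle_deriv x z0 refl)+ simp
      have d2: "((\<lambda>x. q x * (sol z x)\<^sup>2 * angle z x) has_real_derivative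
          (q' x * ?y\<^sup>2 + 2 * ?y * ?v * q x) * ?p + (z - q x / z * ?s\<^sup>2) * (q x * ?y\<^sup>2)) (at x within {0..1})"
        by (rule derivative_eq_intros q' sol_deriv angle_deriv x z0 refl)+ simp
      have d3: "((\<lambda>x. 6 / 5 * q 1 / z * (74 / 75 * E 1 * x - sol z x * dsol z x)) has_real_derivative
          6 / 5 * q 1 / z * (74 / 75 * E 1 - (?v * ?v + (q x - z\<^sup>2) * ?y * ?y))) (at x within {0..1})"
        by (rule derivative_eq_intros sol_deriv dsol_deriv x z0 refl)+ simp
      \<comment> \<open>The term containing \<phi> undifferentiated is
        \<open>- 2 y y' q \<phi>\<close>; it cancels against the derivative of
        \<open>q y\<^sup>2 \<phi>\<close>, which is why that product is part of
        \<open>H\<close>.\<close>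
      have "z\<^sup>2 * (z * (R\<^sup>2 * (1 + q x / z\<^sup>2 * s\<^sup>2)) - (2 * R * (q x / z * s * c * R) * p + (z - q x / z * s\<^sup>2) * R\<^sup>2))
         = 2 * z * q x * (R * s)\<^sup>2 - 2 * (R * s) * (z * R * c) * q x * p" for R s c p :: real
        using z0 by (simp add: field_simps power2_eq_square)
      from this[of ?r ?s "cos ?p" ?p]
      have e1: "z\<^sup>2 * (z * (?r\<^sup>2 * (1 + q x / z\<^sup>2 * ?s\<^sup>2))
            - (2 * ?r * (q x / z * ?s * cos ?p * ?r) * ?p + (z - q x / z * ?s\<^sup>2) * ?r\<^sup>2))
         = 2 * z * q x * ?y\<^sup>2 - 2 * ?y * ?v * q x * ?p" by (simp add: sol_def dsol_def)
      from DERIV_diff[OF DERIV_add[OF d1 d2] d3] show ?thesis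
        unfolding H_def[abs_def] e1
        by (rule DERIV_cong) (unfold H'_def k_def, simp add: algebra_simps power2_eq_square)
    qed
    then show "(H has_real_derivative H') (at x within {0..1})" .
    \<comment> \<open>In units of \<open>q y\<^sup>2 z\<close>, the three terms of \<open>H'\<close>
      contribute at least \<open>32/11\<close>, \<open>- 2/15\<close> and \<open>- 36/13\<close>,
      and the sum of these is positive.\<close>
    show "0 \<le> H'"
    proof -
      have p: "0 \<le> ?p" "?p \<le> z"
        using angle_nonneg[OF z0 x] order_trans[OF angle_le[OF z0 x] mult_left_le[of x z]] x z0 by auto
      have "k * ?s\<^sup>2 \<le> z / 11 * 1"
      proof (rule mult_mono)
        show "k \<le> z / 11" using small[OF x] z0 by (simp add: k_def power2_eq_square field_simps)
      qed (use z0 in \<open>auto simp: abs_square_le_1\<close>)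
      then have "31 / 11 * z + z / 11 \<le> 2 * z + (z - k * ?s\<^sup>2) " by simp
      then have a1: "q x * ?y\<^sup>2 * (32 / 11 * z) \<le> q x * ?y\<^sup>2 * (2 * z + (z - k * ?s\<^sup>2))"
        using nonneg[OF x] by (intro mult_left_mono) auto
      have "\<bar>q' x * ?y\<^sup>2 * ?p\<bar> \<le> (2 / 15 * q x) * ?y\<^sup>2 * z"
        unfolding abs_mult using slow[OF x] nonneg[OF x] p by (intro mult_mono) auto
      then have a2: "- (2 / 15 * (q x * ?y\<^sup>2 * z)) \<le> q' x * ?y\<^sup>2 * ?p" by simp
      have "74 / 75 * E 1 - (?v\<^sup>2 + (q x - z\<^sup>2) * ?y\<^sup>2) \<le> E x - (?v\<^sup>2 + (q x - z\<^sup>2) * ?y\<^sup>2)"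
        using E1_le[OF x] by simp
      also have "\<dots> = 2 * (z\<^sup>2 * ?y\<^sup>2) - 2 * (q x * ?y\<^sup>2)" by (simp add: E_def algebra_simps)
      also have "\<dots> \<le> 2 * (z\<^sup>2 * ?y\<^sup>2)" using nonneg[OF x] by simp
      finally have "6 / 5 * q 1 / z * (74 / 75 * E 1 - (?v\<^sup>2 + (q x - z\<^sup>2) * ?y\<^sup>2))
          \<le> 6 / 5 * q 1 / z * (2 * (z\<^sup>2 * ?y\<^sup>2))"
        using q1 z0 by (intro mult_left_mono) auto
      also have "\<dots> = 12 / 5 * (q 1 * (?y\<^sup>2 * z))" using z0 by (simp add: power2_eq_square)
      also have "\<dots> \<le> 12 / 5 * ((15 / 13 * q x) * (?y\<^sup>2 * z))"
        using drop[OF x] z0 by (intro mult_left_mono mult_right_mono) auto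
      also have "\<dots> = 36 / 13 * (q x * ?y\<^sup>2 * z)" by simp
      finally have a3: "6 / 5 * q 1 / z * (74 / 75 * E 1 - (?v\<^sup>2 + (q x - z\<^sup>2) * ?y\<^sup>2)) \<le> 36 / 13 * (q x * ?y\<^sup>2 * z)" .
      have "0 \<le> q x * ?y\<^sup>2 * z" using nonneg[OF x] z0 by simp
      then show ?thesis using a1 a2 a3 unfolding H'_def by (simp add: algebra_simps)
    qed
  qed auto
  then have "0 \<le> H 1" by (simp add: H_def sol_def)
  define y v where "y = sol z 1" and "v = dsol z 1"
  \<comment> \<open>After \<phi> is bounded by \<open>z\<close>, this is the required estimate of
    \<open>q y\<^sup>2 \<phi>\<close> at 1. The mixed term \<open>y v\<close> gains a factor
    \<open>1/3\<close> from \<open>z \<ge> 3\<close>; splitting it with weights \<open>1/9\<close>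
    and \<open>9/4\<close> leaves positive coefficients for both squares.\<close>
  have "(z * y)\<^sup>2 < 6 / 5 * (74 / 75 * E 1 - y * v)"
  proof -
    have yv: "0 < (z * y)\<^sup>2 + v\<^sup>2"
      using amp_squared[of z 1] amp_pos[of z 1] z0 by (simp add: y_def v_def power_mult_distrib)
    have "y * v \<le> 1 / 3 * (\<bar>z * y\<bar> * \<bar>v\<bar>)"
    proof -
      have "3 * (\<bar>y\<bar> * \<bar>v\<bar>) \<le> z * (\<bar>y\<bar> * \<bar>v\<bar>)" using z by (intro mult_right_mono) auto
      then show ?thesis using z0 abs_ge_self[of "y * v"] by (simp add: abs_mult)
    qed
    moreover have "\<bar>z * y\<bar> * \<bar>v\<bar> \<le> (z * y)\<^sup>2 / 9 + 9 / 4 * v\<^sup>2"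
      using sum_squares_bound[of "\<bar>z * y\<bar> / 3" "3 / 2 * \<bar>v\<bar>"]
      by (simp add: power_divide power_mult_distrib mult.commute)
    moreover have "v\<^sup>2 + 10 / 11 * (z * y)\<^sup>2 \<le> E 1"
      using E_ge[of 1] by (simp add: y_def v_def power_mult_distrib)
    moreover have "Y < 6 / 5 * (74 / 75 * e - w)"
      if "w \<le> 1 / 3 * P" "P \<le> Y / 9 + 9 / 4 * V" "V + 10 / 11 * Y \<le> e" "0 < Y + V" "0 \<le> Y" "0 \<le> V"
      for w P Y V e :: real
      using that by (simp add: field_simps)
    ultimately show ?thesis using yv zero_le_power2[of "z * y"] zero_le_power2[of v] by blast
  qed
  then have "q 1 / z * (z * y)\<^sup>2 < q 1 / z * (6 / 5 * (74 / 75 * E 1 - y * v))"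
    using q1 z0 by (intro mult_strict_left_mono) auto
  moreover have "q 1 * y\<^sup>2 * angle z 1 \<le> q 1 * y\<^sup>2 * z"
    using angle_le[OF z0, of 1] q1 by (intro mult_left_mono) auto
  moreover have "q 1 * y\<^sup>2 * z = q 1 / z * (z * y)\<^sup>2" using z0 by (simp add: power2_eq_square)
  moreover have "6 / 5 * q 1 / z * (74 / 75 * E 1 - y * v) = q 1 / z * (6 / 5 * (74 / 75 * E 1 - y * v))"
    by (simp only: times_divide_eq_left times_divide_eq_right divide_divide_eq_left mult_ac)
  moreover have "0 < X" if "a < b" "c \<le> d" "d = a" "e = b" "0 \<le> X + c - e" for a b c d e X :: real
    using that by linarith
  ultimately have "0 < z\<^sup>2 * (z * ((amp z 1)\<^sup>2 * dangle z 1) - (amp z 1)\<^sup>2 * angle z 1)"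
    using \<open>0 \<le> H 1\<close> unfolding H_def y_def[symmetric] v_def[symmetric] mult_1_right by blast
  also have "\<dots> = z\<^sup>2 * (amp z 1)\<^sup>2 * (z * dangle z 1 - angle z 1)" by (simp add: algebra_simps)
  finally have "0 < z * dangle z 1 - angle z 1"
    by (rule zero_less_mult_pos) (use z0 amp_pos[of z 1] in simp)
  then show ?thesis by simp
qed

end

section \<open>Ratio bound for single-barrier potentials and its equality case\<close>

theorem theorem2p1:
  fixes q q' :: "real \<Rightarrow> real" and x0 :: real and lam :: "nat \<Rightarrow> real"
  assumes nonneg: "\<forall>x\<in>{0..1}. 0 \<le> q x"
    and deriv: "\<forall>x\<in>{0..1}. (q has_real_derivative q' x) (at x within {0..1})"
    and barrier: "single_barrier q x0"
    and bound: "\<forall>x\<in>{0..1}. \<bar>q' x\<bar> \<le> 2 / 15 * min (q 0) (q 1)"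
    and eigenvalues: "dirichlet_eigenvalue_seq q lam"
  shows "(\<forall>m\<ge>1. \<forall>n\<ge>1. lam n > lam m \<and> lam m \<ge> 11 * q x0 \<longrightarrow>
            lam n / lam m \<le> (real n)\<^sup>2 / (real m)\<^sup>2) \<and>
         (q x0 \<le> pi\<^sup>2 / 11 \<longrightarrow>
            (\<forall>m\<ge>1. \<forall>n>m. lam n / lam m \<le> (real n)\<^sup>2 / (real m)\<^sup>2)) \<and>
         ((\<exists>m\<ge>1. \<exists>n\<ge>1. lam n > lam m \<and> lam m \<ge> 11 * q x0 \<and>
              lam n / lam m = (real n)\<^sup>2 / (real m)\<^sup>2) \<longrightarrow>
            (\<forall>x\<in>{0..1}. q x = 0))"
proof -
  have q': "(q has_real_derivative q' x) (at x within {0..1})" if "x \<in> {0..1}" for x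
    using deriv that by blast
  interpret nonneg_potential q
    using nonneg by unfold_locales (auto intro!: continuous_on_of_deriv[OF q'])
  note lam = dirichlet_eigenvalue_seq_eq[OF eigenvalues]
  have x0: "x0 \<in> {0..1}" and up: "mono_on {0..x0} q" and down: "antimono_on {x0..1} q"
    using barrier by (auto simp: single_barrier_def)
  have inc: "q s \<le> q t" if "0 \<le> s" "s \<le> t" "t \<le> x0" for s t
    using monotone_onD[OF up, of s t] that by simp
  have dec: "q t \<le> q s" if "x0 \<le> s" "s \<le> t" "t \<le> 1" for s t
    using monotone_onD[OF down, of s t] that by simp
  have q_le: "q x \<le> q x0" if "x \<in> {0..1}" for x
    using inc[of x x0] dec[of x0 x] that x0 by (cases "x \<le> x0") auto
  define M where "M = min (q 0) (q 1)"
  \<comment> \<open>Left of the transition point \<open>q\<close> is at least \<open>q 0\<close>,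
    right of it at least \<open>q 1\<close>.\<close>
  have M_le: "M \<le> q x" if "x \<in> {0..1}" for x
    using inc[of 0 x] dec[of x 1] that x0 by (cases "x \<le> x0") (auto simp: M_def min_le_iff_disj)
  have q'_le: "\<bar>q' x\<bar> \<le> 2 / 15 * M" if "x \<in> {0..1}" for x
    using bound that by (simp add: M_def)
  have lam_less_iff: "lam m < lam n \<longleftrightarrow> m < n" if "1 \<le> m" "1 \<le> n" for m n
  proof -
    have "strict_mono_on {1..} lam" using eigenvalues by (simp add: dirichlet_eigenvalue_seq_def)
    then show ?thesis using that by (intro strict_mono_on_less[where S = "{1..}"]) auto
  qed
  have lam_pos: "0 < lam m" if "1 \<le> m" for m
    using lam[OF that] root_eigenvalue(1)[OF that] by simp
  have lam_ge: "(real m)\<^sup>2 * pi\<^sup>2 \<le> lam m" if "1 \<le> m" for m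
    using power_mono[OF root_eigenvalue_ge[OF that], of 2] lam[OF that] by (simp add: power_mult_distrib)
  \<comment> \<open>For positive \<open>M\<close> the inequality is strict, which settles the bound
    and the equality case together. The angles at the two roots are \<open>m \<pi>\<close> and
    \<open>n \<pi>\<close>, so the monotone quotient compares the ratio of the roots with
    \<open>n / m\<close>.\<close>
  have strict: "lam n / lam m < (real n)\<^sup>2 / (real m)\<^sup>2"
    if "0 < M" and mn: "1 \<le> m" "m < n" and large: "11 * q x0 \<le> lam m" for m n
  proof -
    let ?a = "root_eigenvalue m" and ?b = "root_eigenvalue n"
    have n: "1 \<le> n" using mn by simp
    have a: "0 < ?a" "?a < ?b" using root_eigenvalue(1)[OF mn(1)] root_eigenvalue_less[OF mn] by auto
    have "3 \<le> real m * pi" using pi_gt3 mn(1) mult_mono[of 1 "real m" 3 pi] by simp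
    then have a3: "3 \<le> ?a" using root_eigenvalue_ge[OF mn(1)] by simp
    have "angle ?a 1 / ?a < angle ?b 1 / ?b"
    proof (rule DERIV_pos_imp_increasing[OF a(2), where f = "\<lambda>z. angle z 1 / z"])
      fix z assume z: "?a \<le> z" "z \<le> ?b"
      have z0: "0 < z" using z a by simp
      have "angle z 1 < z * dangle z 1"
      proof (rule angle_quotient_deriv_pos[OF q'])
        show "3 \<le> z" using z a3 by simp
        show "0 < q 1" using \<open>0 < M\<close> by (simp add: M_def)
        fix x :: real assume x: "x \<in> {0..1}"
        have "11 * q x \<le> ?a\<^sup>2" using q_le[OF x] large lam[OF mn(1)] by simp
        also have "\<dots> \<le> z\<^sup>2" using z a by (intro power_mono) auto
        finally show "11 * q x \<le> z\<^sup>2" .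
        show "\<bar>q' x\<bar> \<le> 2 / 15 * q x" using q'_le[OF x] M_le[OF x] by simp
        \<comment> \<open>Between \<open>x\<close> and 1 the potential rises by at most
          \<open>2/15 M \<le> 2/15 q 1\<close>, whence the factor \<open>13/15\<close>.\<close>
        let ?g = "\<lambda>x. 2 / 15 * M * x - q x"
        have "?g x \<le> ?g 1"
        proof (rule mono_of_deriv_nonneg[where f = ?g and a = 0 and b = 1])
          fix t :: real assume t: "t \<in> {0..1}"
          show "(?g has_real_derivative 2 / 15 * M - q' t) (at t within {0..1})"
            by (rule derivative_eq_intros q' t refl)+ simp
          show "0 \<le> 2 / 15 * M - q' t" using q'_le[OF t] by simp
        qed (use x in auto)
        moreover have "0 \<le> 2 / 15 * M * x" using \<open>0 < M\<close> x by simp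
        moreover have "M \<le> q 1" by (simp add: M_def)
        ultimately show "13 / 15 * q 1 \<le> q x" by simp
      qed
      then have "0 < (dangle z 1 * z - angle z 1 * 1) / (z * z)" using z0 by (simp add: mult.commute)
      moreover have "((\<lambda>z. angle z 1 / z) has_real_derivative (dangle z 1 * z - angle z 1 * 1) / (z * z)) (at z)"
        using z0 by (intro DERIV_divide angle_parameter_deriv DERIV_ident) auto
      ultimately show "\<exists>d. ((\<lambda>z. angle z 1 / z) has_real_derivative d) (at z) \<and> 0 < d" by blast
    qed
    then have "?b / ?a < real n / real m"
      using a mn pi_gt_zero root_eigenvalue(2)[OF mn(1)] root_eigenvalue(2)[OF n] by (simp add: field_simps)
    then have "(?b / ?a)\<^sup>2 < (real n / real m)\<^sup>2" using a by (intro power_strict_mono) auto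
    then show ?thesis using lam[OF mn(1)] lam[OF n] by (simp add: power_divide)
  qed
  \<comment> \<open>Here \<open>M = 0\<close>, so the derivative bound makes \<open>q\<close>
    constant, with value \<open>M\<close>.\<close>
  have zero: "\<forall>x\<in>{0..1}. q x = 0" if "\<not> 0 < M"
  proof
    have M0: "M = 0" using that nonneg[of 0] nonneg[of 1] by (simp add: M_def min_def split: if_splits)
    fix x :: real assume x: "x \<in> {0..1}"
    have const: "q t = q 0" if "t \<in> {0..1}" for t
    proof (rule const_of_deriv_zero[where f = q and a = 0 and b = 1])
      fix s :: real assume s: "s \<in> {0..1}"
      show "(q has_real_derivative 0) (at s within {0..1})"
        using q'[OF s] q'_le[OF s] M0 by simp
    qed (rule that)
    show "q x = 0" using const[OF x] const[of 1] M0 by (simp add: M_def)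
  qed
  \<comment> \<open>With vanishing potential the angle is \<open>z x\<close>, so its value
    \<open>k \<pi>\<close> at 1 gives \<open>z = k \<pi>\<close>, and the ratio bound holds with
    equality.\<close>
  have free: "lam k = (real k * pi)\<^sup>2" if "\<not> 0 < M" and k: "1 \<le> k" for k
  proof -
    let ?z = "root_eigenvalue k"
    have "angle ?z 1 - ?z * 1 = angle ?z 0 - ?z * 0"
    proof (rule const_of_deriv_zero[where f = "\<lambda>x. angle ?z x - ?z * x"])
      fix x :: real assume x: "x \<in> {0..1}"
      show "((\<lambda>x. angle ?z x - ?z * x) has_real_derivative 0) (at x within {0..1})"
        by (rule derivative_eq_intros angle_deriv x refl)+ (use zero[OF that(1)] x in simp)
    qed simp
    then show ?thesis using root_eigenvalue(2)[OF k] lam[OF k] by simp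
  qed
  have main: "lam n / lam m \<le> (real n)\<^sup>2 / (real m)\<^sup>2"
    if mn: "1 \<le> m" "m < n" and large: "11 * q x0 \<le> lam m" for m n
  proof (cases "0 < M")
    case True
    then show ?thesis using strict[OF _ mn large] by simp
  next
    case False
    then show ?thesis using free[OF False, of m] free[OF False, of n] mn by (simp add: power_mult_distrib)
  qed
  show ?thesis
  proof (intro conjI impI allI)
    fix m n :: nat assume "1 \<le> m" "1 \<le> n" "lam m < lam n \<and> 11 * q x0 \<le> lam m"
    then show "lam n / lam m \<le> (real n)\<^sup>2 / (real m)\<^sup>2"
      using main[of m n] lam_less_iff[of m n] by simp
  next
    fix m n :: nat assume "q x0 \<le> pi\<^sup>2 / 11" and mn: "1 \<le> m" "m < n"
    \<comment> \<open>Every eigenvalue is at least \<open>\<pi>\<^sup>2\<close>, so the extra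
      condition puts all of them above the threshold.\<close>
    then have "11 * q x0 \<le> 1 * pi\<^sup>2" by simp
    also have "\<dots> \<le> (real m)\<^sup>2 * pi\<^sup>2" using mn by (intro mult_right_mono) auto
    also have "\<dots> \<le> lam m" by (rule lam_ge[OF mn(1)])
    finally show "lam n / lam m \<le> (real n)\<^sup>2 / (real m)\<^sup>2" by (rule main[OF mn])
  next
    assume "\<exists>m\<ge>1. \<exists>n\<ge>1. lam n > lam m \<and> lam m \<ge> 11 * q x0 \<and>
              lam n / lam m = (real n)\<^sup>2 / (real m)\<^sup>2"
    then obtain m n where "1 \<le> m" "1 \<le> n" "lam m < lam n" "11 * q x0 \<le> lam m"
      "lam n / lam m = (real n)\<^sup>2 / (real m)\<^sup>2" by blast
    then have "\<not> 0 < M" using strict[of m n] lam_less_iff[of m n] by auto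
    then show "\<forall>x\<in>{0..1}. q x = 0" by (rule zero)
  qed
qed

end
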